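(* For every $p\in[0,1)$ there exists $n_0\in\mathbb{N}$ such that for every $n\ge n_0$ the $n$-qubit state $(\mathcal{T}_p)^{\otimes n}(\mathrm{GHZ}_n)$ is not GHZ-distillable.
   Context: $D(\mathcal{H})$ denotes the set of density operators on a finite-dimensional Hilbert space $\mathcal{H}$. The $n$-qubit GHZ state is $\mathrm{GHZ}_n=|\mathrm{GHZ}_n\rangle\langle\mathrm{GHZ}_n|$ with $|\mathrm{GHZ}_n\rangle=\frac{1}{\sqrt2}(|0\rangle^{\otimes n}+|1\rangle^{\otimes n})\in(\mathbb{C}^2)^{\otimes n}$; each of $n$ parties holds one qubit. For $p\in[0,1]$, the noisy teleportation channel $\mathcal{T}_p$ on a qubit is the linear map $\mathcal{T}_p(|i\rangle\langle j|)=p|i\rangle\langle j|+(1-p)\delta_{ij}\frac{\mathbb{1}}{2}$, $i,j\in\{0,1\}$, i.e. $\mathcal{T}_p(\tau)=p\tau+(1-p)\mathbb{1}/2$ for every qubit state $\tau$. (The state $(\mathcal{T}_p)^{\otimes n}(\mathrm{GHZ}_n)$ is what results when the center of a star network, sharing with each of $n$ parties an isotropic state of visibility $p$, locally prepares $\mathrm{GHZ}_n$ and teleports one qubit to each party.) Fidelity: $F(\rho,\sigma)=\left(\mathrm{tr}\sqrt{\sqrt\rho\,\sigma\sqrt\rho}\right)^2$. LOCC maps are the completely positive trace-preserving maps implementable by local operations of the parties and classical communication between them. An $n$-qubit state $\rho$ is GHZ-distillable if there exist $n$-partite LOCC maps $\Lambda_k:D(((\mathbb{C}^2)^{\otimes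 n})^{\otimes k})\to D((\mathbb{C}^2)^{\otimes n})$, $k\in\mathbb{N}$ (each party holding its qubit of each of the $k$ copies), such that $\lim_{k\to\infty}F(\Lambda_k(\rho^{\otimes k}),\mathrm{GHZ}_n)=1$. *)

theory Defs
  imports Complex_Main "Jordan_Normal_Form.Schur_Decomposition"
begin

section \<open>Positive operators, trace and fidelity\<close>

definition trace :: "complex mat \<Rightarrow> complex" where
  "trace A = (\<Sum>i<dim_row A. A $$ (i, i))"

text \<open>In the order on \<^typ>\<open>complex\<close>, \<open>0 \<le> z\<close> means that \<open>z\<close> is real and nonnegative, so
  the following also forces \<open>A\<close> to be Hermitian.\<close>

definition positive_semidef :: "complex mat \<Rightarrow> bool" where
  "positive_semidef A \<longleftrightarrow>
     square_mat A \<and> (\<forall>v\<in>carrier_vec (dim_row A). 0 \<le> (A *\<^sub>v v) \<bullet>c v)"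

text \<open>Meaningful for positive semidefinite \<open>A\<close>, where the square root exists and is unique.\<close>

definition mat_sqrt :: "complex mat \<Rightarrow> complex mat" where
  "mat_sqrt A = (THE B. positive_semidef B \<and> B * B = A)"

definition fidelity :: "complex mat \<Rightarrow> complex mat \<Rightarrow> real" where
  "fidelity \<rho> \<sigma> = (Re (trace (mat_sqrt (mat_sqrt \<rho> * \<sigma> * mat_sqrt \<rho>))))\<^sup>2"

section \<open>Multipartite systems\<close>

text \<open>A list \<open>ds\<close> of local dimensions describes the space
  \<open>\<complex>\<^bsup>ds ! 0\<^esup> \<otimes> \<dots> \<otimes> \<complex>\<^bsup>ds ! (n - 1)\<^esup>\<close>, identified with
  the space of dimension \<open>prod_list ds\<close>. The product basis is numbered in the order of the
  Kronecker product, i.e. in mixed radix notation with the most significant digit first: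
  \<open>digit ds x i\<close> is the \<open>i\<close>-th tensor component of the basis vector with number \<open>x\<close>, and
  \<open>index ds f\<close> is the number of the basis vector with components \<open>f 0, f 1, \<dots>\<close>.\<close>

definition digit :: "nat list \<Rightarrow> nat \<Rightarrow> nat \<Rightarrow> nat" where
  "digit ds x i = x div prod_list (drop (Suc i) ds) mod ds ! i"

definition index :: "nat list \<Rightarrow> (nat \<Rightarrow> nat) \<Rightarrow> nat" where
  "index ds f = (\<Sum>i<length ds. f i * prod_list (drop (Suc i) ds))"

lemma index_Nil [simp]: "index [] f = 0"
  by (simp add: index_def)

lemma index_Cons: "index (d # ds) f = f 0 * prod_list ds + index ds (\<lambda>i. f (Suc i))"
  unfolding index_def by (simp only: length_Cons sum.lessThan_Suc_shift drop_Suc_Cons drop_0)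

lemma index_less:
  "(\<And>i. i < length ds \<Longrightarrow> f i < ds ! i) \<Longrightarrow> index ds f < prod_list ds"
proof (induction ds arbitrary: f)
  case (Cons d ds)
  have "index ds (\<lambda>i. f (Suc i)) < prod_list ds"
    using Cons.prems by (intro Cons.IH) force
  moreover have "Suc (f 0) * prod_list ds \<le> d * prod_list ds"
    using Cons.prems[of 0] by (intro mult_right_mono) auto
  ultimately show ?case by (simp add: index_Cons)
qed simp

lemma digit_index:
  "(\<And>i. i < length ds \<Longrightarrow> f i < ds ! i) \<Longrightarrow> i < length ds \<Longrightarrow> digit ds (index ds f) i = f i"
proof (induction ds arbitrary: f i)
  case (Cons d ds)
  define g where "g = (\<lambda>i. f (Suc i))"
  have g: "\<And>i. i < length ds \<Longrightarrow> g i < ds ! i"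
    using Cons.prems(1) unfolding g_def by force
  have less: "index ds g < prod_list ds" by (rule index_less[OF g])
  show ?case
  proof (cases i)
    case 0
    have "(a * q + r) div q = a" if "r < q" for a q r :: nat using that by simp
    then have "(f 0 * prod_list ds + index ds g) div prod_list ds = f 0" using less by blast
    then show ?thesis using 0 Cons.prems(1)[of 0]
      by (simp add: digit_def index_Cons flip: g_def)
  next
    case (Suc j)
    then have j: "j < length ds" using Cons.prems(2) by simp
    have "prod_list ds = prod_list (take j ds) * prod_list (drop j ds)"
      by (metis append_take_drop_id prod_list.append)
    also have "drop j ds = ds ! j # drop (Suc j) ds" using j by (simp add: Cons_nth_drop_Suc)
    finally have p: "prod_list ds = prod_list (drop (Suc j) ds) * (ds ! j * prod_list (take j ds))"
      by (simp add: ac_simps)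
    have *: "(a * (q * (e * t)) + r) div q mod e = r div q mod e" if "q > 0" for a q e t r :: nat
    proof -
      have "(a * (q * (e * t)) + r) div q = r div q + e * (a * t)"
        using that div_mult_self2[of q r "e * (a * t)"] by (simp add: ac_simps)
      then show ?thesis by simp
    qed
    have "prod_list (drop (Suc j) ds) > 0"
      using p less by (metis gr0I mult_0 not_less0)
    then have "digit (d # ds) (index (d # ds) f) i = digit ds (index ds g) j"
      using * unfolding digit_def Suc index_Cons g_def[symmetric] p by simp
    also have "\<dots> = g j" by (rule Cons.IH[OF g j])
    finally show ?thesis by (simp add: g_def Suc)
  qed
qed simp

text \<open>\<open>local_map ds i d' E\<close> is the linear map \<open>id \<otimes> E \<otimes> id\<close> applying \<open>E\<close>, from operators on
  \<open>\<complex>\<^bsup>ds ! i\<^esup>\<close> to operators on \<open>\<complex>\<^bsup>d'\<^esup>\<close>, to the \<open>i\<close>-th tensor factor: for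
  fixed row and column components of the other factors, \<open>E\<close> acts on the corresponding block.\<close>

definition local_map ::
  "nat list \<Rightarrow> nat \<Rightarrow> nat \<Rightarrow> (complex mat \<Rightarrow> complex mat) \<Rightarrow> complex mat \<Rightarrow> complex mat" where
  "local_map ds i d' E \<rho> =
     (let es = ds[i := d'] in
      mat (prod_list es) (prod_list es) (\<lambda>(a, b).
        E (mat (ds ! i) (ds ! i) (\<lambda>(x, y).
             \<rho> $$ (index ds ((digit es a)(i := x)), index ds ((digit es b)(i := y)))))
        $$ (digit es a i, digit es b i)))"

definition linear_op :: "nat \<Rightarrow> nat \<Rightarrow> (complex mat \<Rightarrow> complex mat) \<Rightarrow> bool" where
  "linear_op d d' E \<longleftrightarrow>
     (\<forall>X\<in>carrier_mat d d. E X \<in> carrier_mat d' d') \<and>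
     (\<forall>X\<in>carrier_mat d d. \<forall>Y\<in>carrier_mat d d. E (X + Y) = E X + E Y) \<and>
     (\<forall>c. \<forall>X\<in>carrier_mat d d. E (c \<cdot>\<^sub>m X) = c \<cdot>\<^sub>m E X)"

definition completely_positive :: "nat \<Rightarrow> nat \<Rightarrow> (complex mat \<Rightarrow> complex mat) \<Rightarrow> bool" where
  "completely_positive d d' E \<longleftrightarrow>
     linear_op d d' E \<and>
     (\<forall>m. \<forall>X\<in>carrier_mat (m * d) (m * d).
        positive_semidef X \<longrightarrow> positive_semidef (local_map [m, d] 1 d' E X))"

section \<open>LOCC\<close>

text \<open>A quantum instrument with outcomes \<open>0, \<dots>, m - 1\<close>.\<close>

definition instrument :: "nat \<Rightarrow> nat \<Rightarrow> nat \<Rightarrow> (nat \<Rightarrow> complex mat \<Rightarrow> complex mat) \<Rightarrow> bool" where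
  "instrument d d' m E \<longleftrightarrow>
     (\<forall>j<m. completely_positive d d' (E j)) \<and>
     (\<forall>X\<in>carrier_mat d d. (\<Sum>j<m. trace (E j X)) = trace X)"

text \<open>\<open>locc ds ds' \<Lambda>\<close>: the map \<open>\<Lambda>\<close> is implemented by an LOCC protocol with finitely many rounds
  which takes the local dimensions \<open>ds\<close> to \<open>ds'\<close>. In each round some party \<open>i\<close> applies an
  instrument to its system (whose dimension may change) and announces the outcome \<open>j\<close> to all
  parties; the remaining protocol \<open>L j\<close> may depend on \<open>j\<close>. A deterministic local operation is an
  instrument with a single outcome.\<close>

inductive locc :: "nat list \<Rightarrow> nat list \<Rightarrow> (complex mat \<Rightarrow> complex mat) \<Rightarrow> bool"
where
  finish: "locc ds ds (\<lambda>\<rho>. \<rho>)"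
| step: "i < length ds \<Longrightarrow> instrument (ds ! i) d' m E \<Longrightarrow>
    (\<And>j. j < m \<Longrightarrow> locc (ds[i := d']) ds' (L j)) \<Longrightarrow>
    locc ds ds' (\<lambda>\<rho>. mat (prod_list ds') (prod_list ds')
      (\<lambda>ab. \<Sum>j<m. L j (local_map ds i d' (E j) \<rho>) $$ ab))"

section \<open>The noisy GHZ state\<close>

abbreviation qubits :: "nat \<Rightarrow> nat list" where
  "qubits n \<equiv> replicate n 2"

definition ghz_vec :: "nat \<Rightarrow> complex vec" where
  "ghz_vec n = complex_of_real (1 / sqrt 2) \<cdot>\<^sub>v
     (unit_vec (2 ^ n) (index (qubits n) (\<lambda>_. 0)) + unit_vec (2 ^ n) (index (qubits n) (\<lambda>_. 1)))"

definition ghz :: "nat \<Rightarrow> complex mat" where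
  "ghz n = mat (2 ^ n) (2 ^ n) (\<lambda>(a, b). ghz_vec n $ a * cnj (ghz_vec n $ b))"

definition matrix_unit :: "nat \<Rightarrow> nat \<Rightarrow> nat \<Rightarrow> complex mat" where
  "matrix_unit d i j = mat d d (\<lambda>(a, b). if a = i \<and> b = j then 1 else 0)"

definition teleport :: "real \<Rightarrow> complex mat \<Rightarrow> complex mat" where
  "teleport p \<tau> = complex_of_real p \<cdot>\<^sub>m \<tau> +
     (complex_of_real (1 - p) * trace \<tau> / 2) \<cdot>\<^sub>m 1\<^sub>m 2"

lemma teleport_matrix_unit:
  assumes "i < 2" "j < 2"
  shows "teleport p (matrix_unit 2 i j) = complex_of_real p \<cdot>\<^sub>m matrix_unit 2 i j +
    (complex_of_real (1 - p) * (if i = j then 1 else 0)) \<cdot>\<^sub>m ((1 / 2) \<cdot>\<^sub>m 1\<^sub>m 2)"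
  using assms
  by (auto simp: teleport_def trace_def matrix_unit_def numeral_2_eq_2 less_Suc_eq intro!: eq_matI)

text \<open>The \<open>n\<close>-fold tensor power of a linear map on qubit operators, i.e. the linear extension of
  \<open>\<Otimes>\<^sub>i |x\<^sub>i\<rangle>\<langle>y\<^sub>i| \<mapsto> \<Otimes>\<^sub>i T (|x\<^sub>i\<rangle>\<langle>y\<^sub>i|)\<close>.\<close>

definition tensor_power_map ::
  "nat \<Rightarrow> (complex mat \<Rightarrow> complex mat) \<Rightarrow> complex mat \<Rightarrow> complex mat" where
  "tensor_power_map n T \<rho> = mat (2 ^ n) (2 ^ n) (\<lambda>(a, b).
     \<Sum>x<2 ^ n. \<Sum>y<2 ^ n. \<rho> $$ (x, y) *
       (\<Prod>i<n. T (matrix_unit 2 (digit (qubits n) x i) (digit (qubits n) y i))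
                 $$ (digit (qubits n) a i, digit (qubits n) b i)))"

section \<open>Distillability\<close>

text \<open>The state \<open>\<rho>\<^bsup>\<otimes>k\<^esup>\<close> of \<open>k\<close> copies of an \<open>n\<close>-qubit state, regrouped by parties: party \<open>i\<close>
  holds a system of dimension \<open>2\<^sup>k\<close> whose \<open>l\<close>-th qubit is the \<open>i\<close>-th qubit of copy \<open>l\<close>.
  \<open>copy_index n k l x\<close> is the basis index of copy \<open>l\<close> within the overall basis index \<open>x\<close>.\<close>

definition copy_index :: "nat \<Rightarrow> nat \<Rightarrow> nat \<Rightarrow> nat \<Rightarrow> nat" where
  "copy_index n k l x =
     index (qubits n) (\<lambda>i. digit (qubits k) (digit (replicate n (2 ^ k)) x i) l)"

definition copies :: "nat \<Rightarrow> nat \<Rightarrow> complex mat \<Rightarrow> complex mat" where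
  "copies n k \<rho> = mat ((2 ^ k) ^ n) ((2 ^ k) ^ n)
     (\<lambda>(x, y). \<Prod>l<k. \<rho> $$ (copy_index n k l x, copy_index n k l y))"

definition ghz_distillable :: "nat \<Rightarrow> complex mat \<Rightarrow> bool" where
  "ghz_distillable n \<rho> \<longleftrightarrow>
     (\<exists>\<Lambda>. (\<forall>k. locc (replicate n (2 ^ k)) (qubits n) (\<Lambda> k)) \<and>
          (\<lambda>k. fidelity (\<Lambda> k (copies n k \<rho>)) (ghz n)) \<longlonglongrightarrow> 1)"

end

theory Submission
  imports Defs "Jordan_Normal_Form.Jordan_Normal_Form_Existence"
    "Jordan_Normal_Form.Jordan_Normal_Form_Uniqueness"
begin

text \<open>The diagonal entries of the noisy GHZ state at the strings \<open>10\<dots>0\<close> and \<open>01\<dots>1\<close> are at least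
  \<open>q\<^sup>n\<^sup>-\<^sup>1 (1 - p) / 4\<close> with \<open>q = (1 + p) / 2 > p\<close>, so for large \<open>n\<close> they dominate the
  coherence \<open>p\<^sup>n / 2\<close>: the state has a positive partial transpose with respect to the first party.
  Positivity of partial transposes survives tensor powers (Schur product theorem) and LOCC: a local
  operation at a party that is not transposed commutes with the transposition, and at a transposed
  party one transposes the complement instead. Finally a state which is PPT across a cut has fidelity
  at most \<open>1 / 2\<close> with the GHZ state, because the partial transpose bounds the coherence
  between \<open>0\<dots>0\<close> and \<open>1\<dots>1\<close> by the populations of two other basis states.\<close>

section \<open>Positive semidefinite kernels\<close>

text \<open>Positivity is studied for kernels on arbitrary index sets, because tensor powers and
  local maps re-index rows and columns by the same map, and such a pullback stays positive even when
  the map is not injective. Ordinary positivity is the case \<open>S = {}\<close> of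
  \<open>ppt S\<close>, so one invariance argument serves for both; the final bound needs both,
  together with unit trace, which is therefore carried through the protocol as well. The obstacle is
  \<open>mat_sqrt\<close>, a definite description: nothing is known about \<open>fidelity\<close>
  until positive square roots are shown to exist and to be unique. Both facts rest on the Jordan
  normal form, whose blocks all have size 1 here. The same square roots supply the factorization
  behind the Schur product theorem.\<close>

definition psd_on :: "'a set \<Rightarrow> ('a \<Rightarrow> 'a \<Rightarrow> complex) \<Rightarrow> bool" where
  "psd_on A K \<longleftrightarrow> (\<forall>v. 0 \<le> (\<Sum>x\<in>A. \<Sum>y\<in>A. cnj (v x) * K x y * v y))"

lemma psd_onD: "psd_on A K \<Longrightarrow> 0 \<le> (\<Sum>x\<in>A. \<Sum>y\<in>A. cnj (v x) * K x y * v y)"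
  by (simp add: psd_on_def)

lemma psd_on_cong:
  "(\<And>x y. x \<in> A \<Longrightarrow> y \<in> A \<Longrightarrow> K x y = L x y) \<Longrightarrow> psd_on A K \<longleftrightarrow> psd_on A L"
  unfolding psd_on_def by (intro all_cong1) (simp cong: sum.cong)

text \<open>Collecting the values of \<open>v\<close> along the fibres of \<open>f\<close> gives a
  vector \<open>w\<close>, and the pulled-back form at \<open>v\<close> is the form of
  \<open>K\<close> at \<open>w\<close>. As \<open>f\<close> may omit and repeat indices, this covers
  principal submatrices as well as tensoring with an all-ones matrix.\<close>

lemma psd_on_pullback:
  fixes f :: "'a \<Rightarrow> 'b"
  assumes psd: "psd_on B K" and fin: "finite A" "finite B" and f: "f ` A \<subseteq> B"
  shows "psd_on A (\<lambda>x y. K (f x) (f y))"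
  unfolding psd_on_def
proof
  fix v :: "'a \<Rightarrow> complex"
  define w where "w = (\<lambda>b. \<Sum>x\<in>{x\<in>A. f x = b}. v x)"
  have group: "(\<Sum>x\<in>A. g x) = (\<Sum>b\<in>B. \<Sum>x\<in>{x\<in>A. f x = b}. g x)" for g :: "'a \<Rightarrow> complex"
    using sum.group[OF fin f, of g] by simp
  have "(\<Sum>x\<in>A. \<Sum>y\<in>A. cnj (v x) * K (f x) (f y) * v y)
      = (\<Sum>b\<in>B. \<Sum>x\<in>{x\<in>A. f x = b}. \<Sum>c\<in>B. \<Sum>y\<in>{y\<in>A. f y = c}. cnj (v x) * K (f x) (f y) * v y)"
    by (simp only: group)
  also have "\<dots> = (\<Sum>b\<in>B. \<Sum>x\<in>{x\<in>A. f x = b}. \<Sum>c\<in>B. \<Sum>y\<in>{y\<in>A. f y = c}. cnj (v x) * K b c * v y)"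
    by (intro sum.cong refl) auto
  also have "\<dots> = (\<Sum>b\<in>B. \<Sum>x\<in>{x\<in>A. f x = b}. \<Sum>c\<in>B. cnj (v x) * K b c * w c)"
    by (simp add: w_def sum_distrib_left)
  also have "\<dots> = (\<Sum>b\<in>B. \<Sum>c\<in>B. \<Sum>x\<in>{x\<in>A. f x = b}. cnj (v x) * K b c * w c)"
    by (intro sum.cong refl sum.swap)
  also have "\<dots> = (\<Sum>b\<in>B. \<Sum>c\<in>B. cnj (w b) * K b c * w c)"
    by (simp add: w_def cnj_sum sum_distrib_right mult.assoc)
  also have "0 \<le> \<dots>" by (rule psd_onD[OF psd])
  finally show "0 \<le> (\<Sum>x\<in>A. \<Sum>y\<in>A. cnj (v x) * K (f x) (f y) * v y)" .
qed

text \<open>The form of the transposed kernel at \<open>v\<close> is the form of \<open>K\<close> at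
  the conjugate of \<open>v\<close>.\<close>

lemma psd_on_swap:
  assumes "psd_on A K" shows "psd_on A (\<lambda>x y. K y x)"
  unfolding psd_on_def
proof
  fix v
  have "(\<Sum>x\<in>A. \<Sum>y\<in>A. cnj (v x) * K y x * v y)
      = (\<Sum>y\<in>A. \<Sum>x\<in>A. cnj (cnj (v y)) * K y x * cnj (v x))"
    by (subst sum.swap) (simp add: mult.commute mult.left_commute)
  then show "0 \<le> (\<Sum>x\<in>A. \<Sum>y\<in>A. cnj (v x) * K y x * v y)"
    using psd_onD[OF assms, of "\<lambda>x. cnj (v x)"] by simp
qed

lemma psd_on_zero [simp]: "psd_on A (\<lambda>_ _. 0)"
  by (simp add: psd_on_def)

lemma psd_on_add:
  assumes "psd_on A K" "psd_on A L" shows "psd_on A (\<lambda>x y. K x y + L x y)"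
  unfolding psd_on_def
proof
  fix v
  show "0 \<le> (\<Sum>x\<in>A. \<Sum>y\<in>A. cnj (v x) * (K x y + L x y) * v y)"
    using add_nonneg_nonneg[OF psd_onD[OF assms(1), of v] psd_onD[OF assms(2), of v]]
    by (simp add: algebra_simps sum.distrib)
qed

lemma psd_on_sum:
  "(\<And>j. j \<in> J \<Longrightarrow> psd_on A (K j)) \<Longrightarrow> psd_on A (\<lambda>x y. \<Sum>j\<in>J. K j x y)"
  by (induction J rule: infinite_finite_induct) (auto intro: psd_on_add)

text \<open>A diagonal congruence: the factor \<open>f\<close> is absorbed into the test vector.
  With \<open>psd_on_one\<close> and \<open>psd_on_sum\<close> this yields all Gram kernels.\<close>

lemma psd_on_rank_one_mult:
  assumes "psd_on A K" shows "psd_on A (\<lambda>x y. f x * cnj (f y) * K x y)"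
  unfolding psd_on_def
proof
  fix v
  show "0 \<le> (\<Sum>x\<in>A. \<Sum>y\<in>A. cnj (v x) * (f x * cnj (f y) * K x y) * v y)"
    using psd_onD[OF assms, of "\<lambda>x. v x * cnj (f x)"] by (simp add: ac_simps)
qed

lemma psd_on_one: "finite A \<Longrightarrow> psd_on A (\<lambda>_ _. 1)"
  unfolding psd_on_def
proof
  fix v assume "finite A"
  have "(\<Sum>x\<in>A. \<Sum>y\<in>A. cnj (v x) * 1 * v y) = cnj (\<Sum>x\<in>A. v x) * (\<Sum>x\<in>A. v x)"
    by (simp add: cnj_sum sum_product)
  also have "0 \<le> \<dots>"
    using complex_mult_cnj[of "\<Sum>x\<in>A. v x"] by (simp add: less_eq_complex_def del: cnj_sum)
  finally show "0 \<le> (\<Sum>x\<in>A. \<Sum>y\<in>A. cnj (v x) * 1 * v y)" .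
qed

lemma quad_form_two:
  assumes "finite A" "x \<in> A" "y \<in> A" "x \<noteq> y" and v: "v = (\<lambda>z. if z = x then a else if z = y then b else 0)"
  shows "(\<Sum>s\<in>A. \<Sum>t\<in>A. cnj (v s) * K s t * v t) =
    cnj a * K x x * a + cnj a * K x y * b + cnj b * K y x * a + cnj b * K y y * (b :: complex)"
proof -
  have *: "(\<Sum>s\<in>A. g s) = g x + g y" if "\<And>s. s \<noteq> x \<Longrightarrow> s \<noteq> y \<Longrightarrow> g s = 0" for g :: "'a \<Rightarrow> complex"
  proof -
    have "(\<Sum>s\<in>A. g s) = (\<Sum>s\<in>{x,y}. g s)"
      using assms that by (intro sum.mono_neutral_right) auto
    then show ?thesis using assms by simp
  qed
  have "(\<Sum>t\<in>A. cnj (v s) * K s t * v t) = cnj (v s) * K s x * a + cnj (v s) * K s y * b" for s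
    using assms(4) by (subst *) (simp_all add: v)
  then show ?thesis
    using assms(4) by (simp only:) (subst *, simp_all add: v algebra_simps)
qed

lemma psd_on_diag:
  assumes "psd_on A K" "finite A" "x \<in> A"
  shows "0 \<le> K x x"
proof -
  have "(\<Sum>s\<in>A. \<Sum>t\<in>A. cnj (if s = x then 1 else 0) * K s t * (if t = x then 1 else 0)) = K x x"
  proof -
    have "cnj (if s = x then 1 else 0) * K s t * (if t = x then 1 else 0) =
        (if t = x then if s = x then K x x else 0 else 0)" for s t
      by simp
    then show ?thesis using assms by simp
  qed
  then show ?thesis using psd_onD[OF assms(1), of "\<lambda>s. if s = x then 1 else 0"] by simp
qed

text \<open>Positivity includes that the form is real. On vectors supported at \<open>x\<close> and
  \<open>y\<close> with coefficients 1 and \<open>b\<close>, the choice \<open>b = 1\<close>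
  compares the imaginary parts of the two entries, and \<open>b = \<i>\<close> their real
  parts.\<close>

lemma psd_on_hermitian:
  assumes psd: "psd_on A K" and A: "finite A" "x \<in> A" "y \<in> A"
  shows "K y x = cnj (K x y)"
proof (cases "x = y")
  case True
  then show ?thesis using psd_on_diag[OF psd A(1,2)] by (simp add: complex_eq_iff less_eq_complex_def)
next
  case False
  have "0 \<le> K x x + K x y * b + cnj b * K y x + cnj b * K y y * b" for b
    using psd_onD[OF psd, of "\<lambda>z. if z = x then 1 else if z = y then b else 0",
        unfolded quad_form_two[OF A False refl]] by simp
  from this[of 1] this[of \<i>] psd_on_diag[OF psd A(1,2)] psd_on_diag[OF psd A(1,3)]
  show ?thesis by (simp add: less_eq_complex_def complex_eq_iff)
qed

lemma psd_on_offdiag: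
  assumes psd: "psd_on A K" and A: "finite A" "x \<in> A" "y \<in> A" "x \<noteq> y"
  shows "2 * Re (K x y) \<le> Re (K x x) + Re (K y y)"
  using psd_onD[OF psd, of "\<lambda>z. if z = x then 1 else if z = y then -1 else 0",
      unfolded quad_form_two[OF A refl]]
    psd_on_hermitian[OF psd A(1-3)]
  by (simp add: less_eq_complex_def)

section \<open>Square roots of positive semidefinite matrices\<close>

abbreviation kernel_of :: "complex mat \<Rightarrow> nat \<Rightarrow> nat \<Rightarrow> complex" where
  "kernel_of A x y \<equiv> A $$ (x, y)"

lemma cscalar_mult_mat_vec:
  assumes "A \<in> carrier_mat n n" "v \<in> carrier_vec n"
  shows "(A *\<^sub>v v) \<bullet>c v = (\<Sum>x<n. \<Sum>y<n. cnj (v $ x) * A $$ (x, y) * v $ y)"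
  using assms
  by (simp add: scalar_prod_def atLeast0LessThan sum_distrib_right sum_distrib_left ac_simps)

lemma positive_semidef_iff:
  assumes A: "A \<in> carrier_mat n n"
  shows "positive_semidef A \<longleftrightarrow> psd_on {..<n} (kernel_of A)"
proof
  assume *: "positive_semidef A"
  show "psd_on {..<n} (kernel_of A)"
    unfolding psd_on_def
  proof
    fix v :: "nat \<Rightarrow> complex"
    show "0 \<le> (\<Sum>x<n. \<Sum>y<n. cnj (v x) * A $$ (x, y) * v y)"
      using * A cscalar_mult_mat_vec[OF A, of "vec n v"]
      by (auto simp: positive_semidef_def dest!: bspec[of _ _ "vec n v"])
  qed
next
  assume "psd_on {..<n} (kernel_of A)"
  then show "positive_semidef A"
    using A cscalar_mult_mat_vec[OF A] by (auto simp: positive_semidef_def psd_on_def)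
qed

section \<open>Adjoints, eigenvectors and diagonalization of positive matrices\<close>

lemma cscalar_prod_sum:
  fixes v w :: "complex vec"
  assumes "w \<in> carrier_vec n"
  shows "v \<bullet>c w = (\<Sum>x<n. v $ x * cnj (w $ x))"
  using assms by (simp add: scalar_prod_def atLeast0LessThan)

lemma cscalar_prod_minus_left:
  fixes u v w :: "complex vec"
  assumes "u \<in> carrier_vec n" "v \<in> carrier_vec n" "w \<in> carrier_vec n"
  shows "(u - v) \<bullet>c w = u \<bullet>c w - v \<bullet>c w"
  using assms by (simp add: cscalar_prod_sum algebra_simps sum_subtractf)

lemma cscalar_prod_smult:
  fixes v w :: "complex vec"
  assumes "v \<in> carrier_vec n" "w \<in> carrier_vec n"
  shows "(c \<cdot>\<^sub>v v) \<bullet>c w = c * (v \<bullet>c w)" "v \<bullet>c (c \<cdot>\<^sub>v w) = cnj c * (v \<bullet>c w)"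
  using assms by (simp_all add: cscalar_prod_sum sum_distrib_left ac_simps)

lemma positive_semidef_adjoint:
  assumes psd: "positive_semidef A" and A: "A \<in> carrier_mat n n"
    and v: "v \<in> carrier_vec n" and w: "w \<in> carrier_vec n"
  shows "(A *\<^sub>v v) \<bullet>c w = v \<bullet>c (A *\<^sub>v w)"
proof -
  have herm: "A $$ (y, x) = cnj (A $$ (x, y))" if "x < n" "y < n" for x y
    using psd_on_hermitian[of "{..<n}" "kernel_of A" x y] psd that positive_semidef_iff[OF A] by auto
  have "(A *\<^sub>v v) \<bullet>c w = (\<Sum>x<n. \<Sum>y<n. A $$ (x, y) * v $ y * cnj (w $ x))"
    using A v w by (simp add: cscalar_prod_sum scalar_prod_def atLeast0LessThan sum_distrib_right)
  also have "\<dots> = (\<Sum>y<n. \<Sum>x<n. A $$ (x, y) * v $ y * cnj (w $ x))"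
    by (rule sum.swap)
  also have "\<dots> = (\<Sum>y<n. \<Sum>x<n. v $ y * cnj (A $$ (y, x) * w $ x))"
  proof (intro sum.cong refl)
    fix x y assume "y \<in> {..<n}" "x \<in> {..<n}"
    then show "A $$ (x, y) * v $ y * cnj (w $ x) = v $ y * cnj (A $$ (y, x) * w $ x)"
      using herm[of y x] by simp
  qed
  also have "\<dots> = v \<bullet>c (A *\<^sub>v w)"
    using A v w by (simp add: cscalar_prod_sum scalar_prod_def atLeast0LessThan sum_distrib_left)
  finally show ?thesis .
qed

lemma char_matrix_mult_vec:
  assumes "(A :: complex mat) \<in> carrier_mat n n" "v \<in> carrier_vec n"
  shows "char_matrix A l *\<^sub>v v = A *\<^sub>v v - l \<cdot>\<^sub>v v"
  using assms unfolding char_matrix_def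
  by (subst add_mult_distrib_mat_vec[of _ n n]) (auto intro!: eq_vecI)

text \<open>There are no proper generalized eigenvectors. If \<open>w = (A - l) v\<close> were
  nonzero, it would be an eigenvector, so \<open>l\<close> would be real and \<open>A - l\<close>
  self-adjoint; then the square norm of \<open>w\<close> is the product of \<open>v\<close> with
  \<open>(A - l) w = 0\<close>.\<close>

lemma positive_semidef_char_matrix_kernel:
  assumes psd: "positive_semidef A" and A: "A \<in> carrier_mat n n" and v: "v \<in> carrier_vec n"
    and 0: "char_matrix A l *\<^sub>v (char_matrix A l *\<^sub>v v) = 0\<^sub>v n"
  shows "char_matrix A l *\<^sub>v v = 0\<^sub>v n"
proof (rule ccontr)
  define w where "w = char_matrix A l *\<^sub>v v"
  have w: "w \<in> carrier_vec n" using A v by (simp add: w_def mult_mat_vec_carrier[of _ n n])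
  assume "\<not> ?thesis"
  then have ww: "w \<bullet>c w \<noteq> 0"
    using conjugate_square_eq_0_vec[OF w] by (simp add: w_def)
  have w_eq: "w = A *\<^sub>v v - l \<cdot>\<^sub>v v" unfolding w_def by (rule char_matrix_mult_vec[OF A v])
  have "A *\<^sub>v w - l \<cdot>\<^sub>v w = 0\<^sub>v n"
    using 0 char_matrix_mult_vec[OF A w] by (simp flip: w_def)
  then have Aw: "A *\<^sub>v w = l \<cdot>\<^sub>v w"
    using A w by (intro eq_vecI) (auto simp: vec_eq_iff dest!: arg_cong[of _ _ "\<lambda>u. u $ _"])
  have "l * (w \<bullet>c w) = cnj l * (w \<bullet>c w)"
    using positive_semidef_adjoint[OF psd A w w] cscalar_prod_smult[OF w w] by (simp add: Aw)
  then have l: "cnj l = l" using ww by simp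
  have "w \<bullet>c w = (A *\<^sub>v v) \<bullet>c w - l * (v \<bullet>c w)"
    using cscalar_prod_minus_left[of "A *\<^sub>v v" n "l \<cdot>\<^sub>v v" w] A v w
    by (simp add: cscalar_prod_smult[OF v w] flip: w_eq)
  also have "(A *\<^sub>v v) \<bullet>c w = l * (v \<bullet>c w)"
    using positive_semidef_adjoint[OF psd A v w] cscalar_prod_smult[OF v w] by (simp add: Aw l)
  finally show False using ww by simp
qed

text \<open>For the sizes \<open>k\<close> of the Jordan blocks of one eigenvalue, the sum of
  \<open>min j k\<close> is the dimension of the \<open>j\<close>-th generalized eigenspace. If it
  does not grow from \<open>j = 1\<close> to \<open>j = 2\<close>, no block is larger than
  1.\<close>

lemma sum_list_min_one_two:
  "(\<Sum>k\<leftarrow>xs. min 2 k) = (\<Sum>k\<leftarrow>xs. min 1 k) \<Longrightarrow> k \<in> set xs \<Longrightarrow> k \<le> (1::nat)"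
proof (induction xs)
  case (Cons a xs)
  have "(\<Sum>k\<leftarrow>xs. min 1 k) \<le> (\<Sum>k\<leftarrow>xs. min 2 (k::nat))"
    by (rule sum_list_mono) auto
  then have "min 2 a = min 1 a \<and> (\<Sum>k\<leftarrow>xs. min 2 k) = (\<Sum>k\<leftarrow>xs. min 1 k)"
    using Cons.prems(1) by auto
  then show ?case using Cons by (auto simp: min_def split: if_splits)
qed simp

lemma jordan_matrix_diagonal:
  assumes "\<And>k a. (k, a) \<in> set n_as \<Longrightarrow> k = 1"
  shows "jordan_matrix n_as = mat_diag (length n_as) (\<lambda>i. snd (n_as ! i))"
  using assms
proof (induction n_as)
  case Nil
  then show ?case by (auto simp: jordan_matrix_def mat_diag_def)
next
  case (Cons na n_as)
  obtain a where na: "na = (1, a)" using Cons.prems by (cases na) auto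
  have *: "sum_list (map fst n_as) = length n_as"
    using Cons.prems by (induction n_as) force+
  have IH: "jordan_matrix n_as = mat_diag (length n_as) (\<lambda>i. snd (n_as ! i))"
    using Cons by (metis list.set_intros(2))
  show ?case
    unfolding na jordan_matrix_Cons * IH
    by (rule eq_matI) (auto simp: mat_diag_def four_block_mat_def nth_Cons' Let_def)
qed

text \<open>A Jordan block of size at least 2 for \<open>l\<close> would make the kernel of the
  square of \<open>A - l\<close> larger than that of \<open>A - l\<close>. The matrix
  \<open>P\<close> obtained this way is merely invertible; nothing is claimed about
  unitarity.\<close>

lemma positive_semidef_diagonalizable:
  assumes psd: "positive_semidef A" and A: "A \<in> carrier_mat n n"
  obtains P Q d where "similar_mat_wit A (mat_diag n d) P Q"
proof -
  obtain n_as where jnf: "jordan_nf A n_as"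
    using char_poly_factorized[OF A] jordan_nf_exists[OF A] by blast
  have "k = 1" if "(k, l) \<in> set n_as" for k l
  proof -
    define N where "N = char_matrix A l"
    have N: "N \<in> carrier_mat n n" using A by (simp add: N_def)
    have "N ^\<^sub>m 2 = N * N" using N by (simp add: numeral_2_eq_2)
    moreover have "N ^\<^sub>m 1 = N" using N by simp
    moreover have "mat_kernel (N * N) = mat_kernel N"
    proof -
      have "N *\<^sub>v v = 0\<^sub>v n" if "v \<in> carrier_vec n" "N * N *\<^sub>v v = 0\<^sub>v n" for v
        using positive_semidef_char_matrix_kernel[OF psd A, of v l] that N
        by (simp add: N_def[symmetric] assoc_mult_mat_vec[OF N N])
      moreover have "N * N *\<^sub>v v = 0\<^sub>v n" if "v \<in> carrier_vec n" "N *\<^sub>v v = 0\<^sub>v n" for v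
        using that N by (auto simp: assoc_mult_mat_vec[OF N N] intro!: eq_vecI)
      ultimately show ?thesis
        unfolding mat_kernel[OF mult_carrier_mat[OF N N]] mat_kernel[OF N] by blast
    qed
    ultimately have "dim_gen_eigenspace A l 2 = dim_gen_eigenspace A l 1"
      using N by (simp add: dim_gen_eigenspace_def N_def[symmetric] kernel_dim_def)
    then have "k \<le> 1"
      using that unfolding dim_gen_eigenspace[OF jnf]
      by (intro sum_list_min_one_two[of "map fst (filter (\<lambda>(k, e). e = l) n_as)"]) force+
    \<comment> \<open>A Jordan normal form has no blocks of size 0.\<close>
    then show ?thesis using jnf that unfolding jordan_nf_def by force
  qed
  then have J: "jordan_matrix n_as = mat_diag (length n_as) (\<lambda>i. snd (n_as ! i))"
    by (rule jordan_matrix_diagonal)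
  obtain P Q where sim: "similar_mat_wit A (jordan_matrix n_as) P Q"
    using jnf unfolding jordan_nf_def similar_mat_def by blast
  then have "jordan_matrix n_as \<in> carrier_mat n n" using similar_mat_witD2[OF A] by blast
  then have "length n_as = n" unfolding J by (metis carrier_matD(1) mat_diag_dim)
  then show ?thesis using that sim unfolding J by blast
qed

lemma similar_diag_eigenvector:
  assumes A: "(A :: complex mat) \<in> carrier_mat n n" and sim: "similar_mat_wit A (mat_diag n d) P Q" and i: "i < n"
  shows "A *\<^sub>v col P i = d i \<cdot>\<^sub>v col P i" "col P i \<noteq> 0\<^sub>v n" "col P i \<in> carrier_vec n"
proof -
  note wit = similar_mat_witD2[OF A sim]
  have "A * P = P * mat_diag n d * Q * P"
    using wit(3) by simp
  also have "\<dots> = P * mat_diag n d * (Q * P)"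
    by (rule assoc_mult_mat[OF mult_carrier_mat[OF wit(6) mat_diag_dim] wit(7,6)])
  finally have "A * P = P * mat_diag n d * (Q * P)" .
  then have AP: "A * P = P * mat_diag n d" using wit by simp
  have "A *\<^sub>v col P i = col (P * mat_diag n d) i"
    using col_mult2[OF A wit(6) i] by (simp add: AP)
  also have "\<dots> = d i \<cdot>\<^sub>v col P i"
    using wit(6) i by (intro eq_vecI) (auto simp: mat_diag_mult_right[OF wit(6)])
  finally show "A *\<^sub>v col P i = d i \<cdot>\<^sub>v col P i" .
  show "col P i \<in> carrier_vec n" using wit(6) i by auto
  show "col P i \<noteq> 0\<^sub>v n"
  proof
    assume "col P i = 0\<^sub>v n"
    then have "col (Q * P) i = 0\<^sub>v n"
      using col_mult2[OF wit(7,6) i] wit(7) by (auto intro!: eq_vecI)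
    then have "unit_vec n i = (0\<^sub>v n :: complex vec)" using wit(2) i by simp
    then show False using i by (metis index_unit_vec(1) index_zero_vec(1) zero_neq_one)
  qed
qed

lemma positive_semidef_eigenvalue:
  assumes psd: "positive_semidef A" and A: "A \<in> carrier_mat n n" and v: "v \<in> carrier_vec n" "v \<noteq> 0\<^sub>v n"
    and eig: "A *\<^sub>v v = l \<cdot>\<^sub>v v"
  shows "0 \<le> l"
proof -
  have vv: "0 \<le> v \<bullet>c v" "v \<bullet>c v \<noteq> 0"
    using v conjugate_square_eq_0_vec[OF v(1)] by (auto intro: conjugate_square_ge_0_vec)
  have "0 \<le> l * (v \<bullet>c v)"
    using psd A v(1) cscalar_prod_smult(1)[OF v(1) v(1), of l]
    by (auto simp: positive_semidef_def dest!: bspec[of _ _ v] simp flip: eig)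
  with vv show ?thesis
    by (auto simp: less_eq_complex_def complex_eq_iff zero_le_mult_iff)
qed

text \<open>The root is \<open>P * G * Q\<close> with the roots of the eigenvalues in
  \<open>G\<close>. Since \<open>P\<close> need not be unitary, positivity requires an argument: at
  \<open>v = P c\<close> the form has the kernel \<open>g j * L i j\<close>, where \<open>L\<close>
  is the Gram matrix of the eigenvectors. Eigenvectors of different eigenvalues are orthogonal, so
  \<open>L i j\<close> vanishes unless \<open>d i = d j\<close>, and this makes the one-sided factor
  \<open>g j\<close> symmetric.\<close>

lemma positive_semidef_sqrt_exists:
  assumes psd: "positive_semidef A" and A: "A \<in> carrier_mat n n"
  obtains B where "B \<in> carrier_mat n n" "positive_semidef B" "B * B = A"
proof -
  obtain P Q d where sim: "similar_mat_wit A (mat_diag n d) P Q"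
    using positive_semidef_diagonalizable[OF psd A] .
  note wit = similar_mat_witD2[OF A sim]
  note eig = similar_diag_eigenvector[OF A sim]
  have d: "0 \<le> d i" if "i < n" for i
    using positive_semidef_eigenvalue[OF psd A eig(3,2,1)] that by simp
  define g where "g = (\<lambda>i. complex_of_real (sqrt (Re (d i))))"
  define G where "G = mat_diag n g"
  define B where "B = P * G * Q"
  have G: "G \<in> carrier_mat n n" by (simp add: G_def)
  have B: "B \<in> carrier_mat n n" using wit G by (simp add: B_def)
  have "g i * g i = d i" if "i < n" for i
    using d[OF that] by (simp add: g_def less_eq_complex_def complex_eq_iff)
  then have GG: "G * G = mat_diag n d"
    unfolding G_def mat_diag_diag by (auto simp: mat_diag_def intro!: eq_matI)
  have "Q * (P * (G * Q)) = G * Q"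
    using wit(2,6,7) G assoc_mult_mat[OF wit(7,6), of "G * Q" n] by simp
  then have "B * B = P * (G * G) * Q"
    using wit(6,7) G by (simp add: B_def assoc_mult_mat[of _ n n _ n _ n])
  then have BB: "B * B = A" using wit(3) by (simp add: GG)
  define L where "L = (\<lambda>i j. col P j \<bullet>c col P i)"
  \<comment> \<open>The double conjugate and the factor 1 give the summands the shape required by
    \<open>psd_on_rank_one_mult\<close> over the constant kernel.\<close>
  have P_entries: "L i j = (\<Sum>x<n. cnj (P $$ (x, i)) * cnj (cnj (P $$ (x, j))) * 1)" if "i < n" "j < n" for i j
    using wit(6) that by (simp add: L_def cscalar_prod_sum[of _ n] mult.commute)
  have "psd_on {..<n} (\<lambda>i j. \<Sum>x<n. cnj (P $$ (x, i)) * cnj (cnj (P $$ (x, j))) * 1)"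
    by (intro psd_on_sum psd_on_rank_one_mult psd_on_one) simp
  then have L: "psd_on {..<n} L"
    by (subst psd_on_cong[OF P_entries]) simp_all
  have L0: "L i j = 0" if "i < n" "j < n" "d i \<noteq> d j" for i j
  proof -
    have "d j * L i j = cnj (d i) * L i j"
      using positive_semidef_adjoint[OF psd A eig(3)[OF that(2)] eig(3)[OF that(1)]]
      unfolding L_def eig(1)[OF that(1)] eig(1)[OF that(2)]
      by (simp add: cscalar_prod_smult[OF eig(3)[OF that(2)] eig(3)[OF that(1)]])
    moreover have "cnj (d i) = d i" using d[OF that(1)] by (simp add: less_eq_complex_def complex_eq_iff)
    ultimately show ?thesis using that(3) by simp
  qed
  \<comment> \<open>Fourth roots of the eigenvalues split \<open>g j\<close> evenly between row and
    column wherever \<open>L i j\<close> is nonzero, so that multiplying by \<open>g\<close> becomes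
    a diagonal congruence by \<open>h\<close>.\<close>
  define h where "h = (\<lambda>i. complex_of_real (sqrt (sqrt (Re (d i)))))"
  have hL: "h i * cnj (h j) * L i j = g j * L i j" if "i < n" "j < n" for i j
  proof (cases "d i = d j")
    case True
    have "h j * h j = g j"
      using d[OF that(2)] by (simp add: h_def g_def less_eq_complex_def flip: of_real_mult)
    moreover have "h i = h j" "cnj (h j) = h j" using True by (simp_all add: h_def)
    ultimately show ?thesis by simp
  qed (simp add: L0[OF that])
  have gL: "psd_on {..<n} (\<lambda>i j. g j * L i j)"
    by (rule psd_on_cong[THEN iffD1, OF _ psd_on_rank_one_mult[OF L, of h]]) (use hL in auto)
  have "0 \<le> (B *\<^sub>v v) \<bullet>c v" if v: "v \<in> carrier_vec n" for v
  proof -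
    define c where "c = Q *\<^sub>v v"
    have c: "c \<in> carrier_vec n" using wit v by (simp add: c_def mult_mat_vec_carrier[of _ n n])
    have v_eq: "v = P *\<^sub>v c"
      using wit v by (simp add: c_def flip: assoc_mult_mat_vec[of _ n n _ n])
    have Bv: "B *\<^sub>v v = P *\<^sub>v (G *\<^sub>v c)"
      using wit v G by (simp add: B_def c_def assoc_mult_mat_vec[of _ n n _ n] mult_mat_vec_carrier[of _ n n])
    have Gc: "G *\<^sub>v c = vec n (\<lambda>i. g i * c $ i)"
      using c by (intro eq_vecI) (auto simp: G_def mat_diag_def scalar_prod_def if_distrib if_distribR
          cong: if_cong)
    have "(B *\<^sub>v v) \<bullet>c v = (\<Sum>x<n. (\<Sum>j<n. P $$ (x, j) * (g j * c $ j)) * cnj (\<Sum>i<n. P $$ (x, i) * c $ i))"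
      unfolding Bv Gc using wit(6) c
      by (subst v_eq) (simp add: cscalar_prod_sum[of _ n] mult_mat_vec_carrier[of _ n n]
          scalar_prod_def atLeast0LessThan)
    also have "\<dots> = (\<Sum>x<n. \<Sum>i<n. \<Sum>j<n. cnj (c $ i) * (g j * (cnj (P $$ (x, i)) * cnj (cnj (P $$ (x, j))) * 1)) * c $ j)"
      by (subst mult.commute) (simp add: sum_product ac_simps)
    also have "\<dots> = (\<Sum>i<n. \<Sum>x<n. \<Sum>j<n. cnj (c $ i) * (g j * (cnj (P $$ (x, i)) * cnj (cnj (P $$ (x, j))) * 1)) * c $ j)"
      by (rule sum.swap)
    also have "\<dots> = (\<Sum>i<n. \<Sum>j<n. \<Sum>x<n. cnj (c $ i) * (g j * (cnj (P $$ (x, i)) * cnj (cnj (P $$ (x, j))) * 1)) * c $ j)"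
      by (intro sum.cong refl sum.swap)
    also have "\<dots> = (\<Sum>i<n. \<Sum>j<n. cnj (c $ i) * (g j * L i j) * c $ j)"
    proof (intro sum.cong refl)
      fix i j assume "i \<in> {..<n}" "j \<in> {..<n}"
      then show "(\<Sum>x<n. cnj (c $ i) * (g j * (cnj (P $$ (x, i)) * cnj (cnj (P $$ (x, j))) * 1)) * c $ j)
          = cnj (c $ i) * (g j * L i j) * c $ j"
        by (simp add: P_entries sum_distrib_left sum_distrib_right)
    qed
    also have "0 \<le> \<dots>" by (rule psd_onD[OF gL])
    finally show ?thesis .
  qed
  then have "positive_semidef B" using B by (auto simp: positive_semidef_def)
  then show ?thesis using that B BB by blast
qed

lemma vec_minus_eq_zero:
  assumes "(u :: complex vec) \<in> carrier_vec n" "v \<in> carrier_vec n" "u - v = 0\<^sub>v n"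
  shows "u = v"
proof (rule eq_vecI)
  fix i assume "i < dim_vec v"
  then show "u $ i = v $ i"
    using assms(1,2) arg_cong[OF assms(3), of "\<lambda>u. u $ i"] by simp
qed (use assms in auto)

text \<open>Any eigenvector of one square root \<open>C\<close> with eigenvalue \<open>\<mu>\<close> is an eigenvector of every
  other one \<open>B\<close> with the same eigenvalue, because \<open>(B + \<mu>) (B - \<mu>) v = 0\<close>.\<close>

lemma positive_semidef_sqrt_unique:
  assumes B: "B \<in> carrier_mat n n" and psdB: "positive_semidef B"
    and C: "C \<in> carrier_mat n n" and psdC: "positive_semidef C" and BC: "B * B = C * C"
  shows "B = C"
proof -
  obtain P Q d where sim: "similar_mat_wit C (mat_diag n d) P Q"
    using positive_semidef_diagonalizable[OF psdC C] .
  note wit = similar_mat_witD2[OF C sim]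
  have "col (B * P) i = col (C * P) i" if i: "i < n" for i
  proof -
    define v where "v = col P i"
    define m where "m = d i"
    note eig = similar_diag_eigenvector[OF C sim i, folded v_def m_def]
    note v = eig(3)
    have m: "0 \<le> m" by (rule positive_semidef_eigenvalue[OF psdC C eig(3,2,1)])
    have Bv: "B *\<^sub>v v \<in> carrier_vec n" using B v by (simp add: mult_mat_vec_carrier[of _ n n])
    have "B *\<^sub>v (B *\<^sub>v v) = C *\<^sub>v (C *\<^sub>v v)"
      by (simp only: assoc_mult_mat_vec[OF B B v, symmetric] assoc_mult_mat_vec[OF C C v, symmetric] BC)
    also have "\<dots> = m * m \<cdot>\<^sub>v v"
      unfolding eig(1) mult_mat_vec[OF C v] by (simp add: smult_smult_assoc)
    finally have BBv: "B *\<^sub>v (B *\<^sub>v v) = m * m \<cdot>\<^sub>v v" .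
    define w where "w = B *\<^sub>v v - m \<cdot>\<^sub>v v"
    have w: "w \<in> carrier_vec n" using Bv v by (simp add: w_def)
    have "B *\<^sub>v w = B *\<^sub>v (B *\<^sub>v v) - m \<cdot>\<^sub>v (B *\<^sub>v v)"
      using B v Bv by (simp add: w_def mult_minus_distrib_mat_vec[of _ n n] mult_mat_vec[of _ n n])
    also have "\<dots> = (- m) \<cdot>\<^sub>v w"
      unfolding BBv w_def using B v Bv by (intro eq_vecI) (simp_all add: algebra_simps)
    finally have Bw: "B *\<^sub>v w = (- m) \<cdot>\<^sub>v w" .
    \<comment> \<open>For \<open>m > 0\<close>, a nonzero \<open>w\<close> would be an eigenvector
      of the positive matrix \<open>B\<close> with eigenvalue \<open>- m < 0\<close>. For
      \<open>m = 0\<close> this gives no contradiction, but then applying \<open>B\<close> twice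
      annihilates \<open>v\<close>, hence applying it once does.\<close>
    have "w = 0\<^sub>v n"
    proof (cases "m = 0")
      case True
      have "char_matrix B 0 *\<^sub>v u = B *\<^sub>v u" if "u \<in> carrier_vec n" for u
        using char_matrix_mult_vec[OF B that, of 0] B that by (auto intro!: eq_vecI)
      moreover have "0 \<cdot>\<^sub>v v = 0\<^sub>v n" using v by (intro eq_vecI) auto
      ultimately have "char_matrix B 0 *\<^sub>v v = 0\<^sub>v n"
        using positive_semidef_char_matrix_kernel[OF psdB B v, of 0] BBv True v Bv by auto
      then show ?thesis
        using char_matrix_mult_vec[OF B v, of 0] True by (simp add: w_def)
    next
      case False
      then show ?thesis
        using positive_semidef_eigenvalue[OF psdB B w _ Bw] m by (auto simp: less_eq_complex_def complex_eq_iff)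
    qed
    then have "B *\<^sub>v v = m \<cdot>\<^sub>v v"
      using vec_minus_eq_zero[OF Bv, of "m \<cdot>\<^sub>v v"] v by (simp add: w_def)
    then show ?thesis
      using col_mult2[OF B wit(6) i] col_mult2[OF C wit(6) i] eig(1) by (simp add: v_def)
  qed
  then have "B * P = C * P"
    using B C wit(6) by (intro mat_col_eqI) auto
  then have "B * P * Q = C * P * Q" by simp
  then show ?thesis using B C wit by (simp add: assoc_mult_mat[of _ n n _ n _ n])
qed

section \<open>The square root as a definite description; fidelity with a pure state\<close>

lemma mat_sqrt_eqI:
  assumes "B \<in> carrier_mat n n" "positive_semidef B" "B * B = A"
  shows "mat_sqrt A = B"
  unfolding mat_sqrt_def
proof (rule the_equality)
  fix C assume C: "positive_semidef C \<and> C * C = A"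
  \<comment> \<open>The description does not mention the dimension of the root; it is recovered from
    \<open>C * C = A\<close>.\<close>
  have "dim_row C = dim_row A" "dim_row A = n"
    using C assms by (metis index_mult_mat(2), metis index_mult_mat(2) carrier_matD(1))
  then have "C \<in> carrier_mat n n" using C by (auto simp: positive_semidef_def)
  then show "C = B" using positive_semidef_sqrt_unique[OF _ _ assms(1,2), of C] C assms(3) by simp
qed (use assms in auto)

lemma mat_sqrt:
  assumes "positive_semidef A" "A \<in> carrier_mat n n"
  shows "mat_sqrt A \<in> carrier_mat n n" "positive_semidef (mat_sqrt A)" "mat_sqrt A * mat_sqrt A = A"
  using positive_semidef_sqrt_exists[OF assms] mat_sqrt_eqI by metis+

definition outer :: "nat \<Rightarrow> complex vec \<Rightarrow> complex mat" where
  "outer n w = mat n n (\<lambda>(a, b). w $ a * cnj (w $ b))"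

lemma outer_carrier [simp]: "outer n w \<in> carrier_mat n n"
  by (simp add: outer_def)

text \<open>An outer product squares to \<open>r\<close> times itself, so dividing it by
  \<open>sqrt r\<close> gives the root.\<close>

lemma mat_sqrt_outer:
  assumes w: "w \<in> carrier_vec n" and r: "w \<bullet>c w = complex_of_real r"
  shows "mat_sqrt (outer n w) = complex_of_real (1 / sqrt r) \<cdot>\<^sub>m outer n w"
proof (rule mat_sqrt_eqI)
  have r0: "0 \<le> r"
    using conjugate_square_ge_0_vec[of w] r by (simp add: less_eq_complex_def)
  define s where "s = complex_of_real (1 / sqrt r)"
  have s: "s = complex_of_real (sqrt (1 / sqrt r)) * cnj (complex_of_real (sqrt (1 / sqrt r)))"
    using r0 by (simp add: s_def flip: of_real_mult)
  have "psd_on {..<n} (\<lambda>a b. (sqrt (1 / sqrt r) * w $ a) * cnj (sqrt (1 / sqrt r) * w $ b) * 1)"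
    by (intro psd_on_rank_one_mult psd_on_one) simp
  then have "psd_on {..<n} (kernel_of (s \<cdot>\<^sub>m outer n w))"
    by (rule psd_on_cong[THEN iffD1, rotated]) (simp add: outer_def s ac_simps)
  then show "positive_semidef (s \<cdot>\<^sub>m outer n w)"
    using positive_semidef_iff[of "s \<cdot>\<^sub>m outer n w" n] by simp
  show "s \<cdot>\<^sub>m outer n w \<in> carrier_mat n n" by simp
  \<comment> \<open>For \<open>r = 0\<close>, division by zero makes \<open>s = 0\<close>; the
    identity is still true because \<open>w\<close> vanishes.\<close>
  have rs: "s * s * complex_of_real r * c = c" if "r = 0 \<Longrightarrow> c = 0" for c
    using r0 that by (cases "r = 0") (auto simp: s_def simp flip: of_real_mult)
  have w0: "w $ a = 0" if "r = 0" "a < n" for a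
    using r conjugate_square_eq_0_vec[OF w] that by simp
  show "s \<cdot>\<^sub>m outer n w * (s \<cdot>\<^sub>m outer n w) = outer n w"
  proof (rule eq_matI)
    fix a b assume "a < dim_row (outer n w)" "b < dim_col (outer n w)"
    then have ab: "a < n" "b < n" by (simp_all add: outer_def)
    have "(s \<cdot>\<^sub>m outer n w * (s \<cdot>\<^sub>m outer n w)) $$ (a, b)
        = (\<Sum>x<n. (s * (w $ a * cnj (w $ x))) * (s * (w $ x * cnj (w $ b))))"
      using ab by (simp add: outer_def scalar_prod_def atLeast0LessThan)
    also have "\<dots> = s * s * (w \<bullet>c w) * (w $ a * cnj (w $ b))"
      by (simp add: cscalar_prod_sum[OF w] sum_distrib_left sum_distrib_right ac_simps)
    also have "\<dots> = w $ a * cnj (w $ b)"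
      unfolding r by (rule rs) (use w0 ab in simp)
    finally show "(s \<cdot>\<^sub>m outer n w * (s \<cdot>\<^sub>m outer n w)) $$ (a, b) = outer n w $$ (a, b)"
      using ab by (simp add: outer_def)
  qed (simp_all add: outer_def)
qed

text \<open>Conjugating the outer product of \<open>g\<close> by the root \<open>S\<close> gives the
  outer product of \<open>w = S g\<close>. Its square root has trace equal to the norm of
  \<open>w\<close>, whose square is the expectation of \<open>\<sigma>\<close> at
  \<open>g\<close>.\<close>

lemma fidelity_outer:
  assumes \<sigma>: "\<sigma> \<in> carrier_mat n n" and psd: "positive_semidef \<sigma>" and g: "g \<in> carrier_vec n"
  shows "fidelity \<sigma> (outer n g) = Re ((\<sigma> *\<^sub>v g) \<bullet>c g)"
proof -
  define S where "S = mat_sqrt \<sigma>"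
  note S = mat_sqrt[OF psd \<sigma>, folded S_def]
  define w where "w = S *\<^sub>v g"
  have w: "w \<in> carrier_vec n" using S g by (simp add: w_def mult_mat_vec_carrier[of _ n n])
  have herm: "S $$ (x, y) = cnj (S $$ (y, x))" if "x < n" "y < n" for x y
    using psd_on_hermitian[of "{..<n}" "kernel_of S" y x] S positive_semidef_iff[OF S(1)] that by auto
  have SGS: "S * outer n g * S = outer n w"
  proof (rule eq_matI)
    fix a b assume "a < dim_row (outer n w)" "b < dim_col (outer n w)"
    then have ab: "a < n" "b < n" by (simp_all add: outer_def)
    have "(S * outer n g * S) $$ (a, b)
        = (\<Sum>y<n. (\<Sum>x<n. S $$ (a, x) * (g $ x * cnj (g $ y))) * S $$ (y, b))"
      using ab S(1) by (simp add: outer_def scalar_prod_def atLeast0LessThan)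
    also have "\<dots> = (\<Sum>y<n. (\<Sum>x<n. S $$ (a, x) * g $ x) * (cnj (S $$ (b, y)) * cnj (g $ y)))"
      using herm[OF _ ab(2)] by (intro sum.cong refl) (simp add: sum_distrib_left sum_distrib_right ac_simps)
    also have "\<dots> = w $ a * cnj (w $ b)"
      using ab S(1) g
      by (simp add: w_def scalar_prod_def atLeast0LessThan sum_distrib_left)
    finally show "(S * outer n g * S) $$ (a, b) = outer n w $$ (a, b)"
      using ab by (simp add: outer_def)
  qed (use S in \<open>simp_all add: outer_def\<close>)
  define r where "r = Re (w \<bullet>c w)"
  have r: "w \<bullet>c w = complex_of_real r" "0 \<le> r"
    using conjugate_square_ge_0_vec[of w] by (simp_all add: r_def less_eq_complex_def complex_eq_iff)
  have "trace (complex_of_real (1 / sqrt r) \<cdot>\<^sub>m outer n w) = complex_of_real (1 / sqrt r) * (w \<bullet>c w)"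
    by (simp add: trace_def outer_def cscalar_prod_sum[OF w] sum_distrib_left)
  also have "\<dots> = complex_of_real (sqrt r)"
    unfolding r(1) of_real_mult[symmetric] using r(2) by (simp add: real_div_sqrt)
  finally have "fidelity \<sigma> (outer n g) = r"
    using r(2) unfolding fidelity_def S_def[symmetric] SGS mat_sqrt_outer[OF w r(1)] by simp
  also have "w \<bullet>c w = (\<sigma> *\<^sub>v g) \<bullet>c g"
    using positive_semidef_adjoint[OF S(2,1) w g] assoc_mult_mat_vec[OF S(1,1) g]
    by (simp add: w_def S(3))
  ultimately show ?thesis by (simp add: r_def)
qed

section \<open>Mixed radix digits\<close>

lemma index_cong:
  "(\<And>i. i < length ds \<Longrightarrow> f i = g i) \<Longrightarrow> index ds f = index ds g"
  unfolding index_def by (intro sum.cong) auto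

definition digit_vectors :: "nat list \<Rightarrow> (nat \<Rightarrow> nat) set" where
  "digit_vectors ds = (\<Pi>\<^sub>E i\<in>{..<length ds}. {..<ds ! i})"

text \<open>Injectivity comes from recovering the digits, surjectivity from counting. Extensional
  functions make the digit vector of a number unique.\<close>

lemma bij_betw_index: "bij_betw (index ds) (digit_vectors ds) {..<prod_list ds}"
proof -
  have inj: "inj_on (index ds) (digit_vectors ds)"
  proof (rule inj_onI)
    fix f g assume fg: "f \<in> digit_vectors ds" "g \<in> digit_vectors ds" "index ds f = index ds g"
    show "f = g"
    proof (rule PiE_ext[OF fg(1,2)[unfolded digit_vectors_def]])
      fix i assume "i \<in> {..<length ds}"
      then show "f i = g i"
        using digit_index[of ds f i] digit_index[of ds g i] fg by (auto simp: digit_vectors_def PiE_iff)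
    qed
  qed
  have "card (digit_vectors ds) = prod_list ds"
    by (simp add: digit_vectors_def card_PiE prod.list_conv_set_nth atLeast0LessThan)
  moreover have "index ds ` digit_vectors ds \<subseteq> {..<prod_list ds}"
    by (auto simp: digit_vectors_def PiE_iff intro!: index_less)
  ultimately have "index ds ` digit_vectors ds = {..<prod_list ds}"
    using card_image[OF inj] by (intro card_subset_eq) auto
  with inj show ?thesis by (simp add: bij_betw_def)
qed

lemma digit_less: "x < prod_list ds \<Longrightarrow> i < length ds \<Longrightarrow> digit ds x i < ds ! i"
proof -
  assume "x < prod_list ds" "i < length ds"
  then have "ds ! i \<noteq> 0" by (metis less_nat_zero_code nth_mem prod_list_zero_iff)
  then show ?thesis by (simp add: digit_def)
qed

lemma index_digit: "x < prod_list ds \<Longrightarrow> index ds (digit ds x) = x"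
proof -
  assume "x < prod_list ds"
  then obtain f where f: "f \<in> digit_vectors ds" "x = index ds f"
    using bij_betw_index[of ds] by (auto simp: bij_betw_def)
  then show ?thesis
    using digit_index[of ds f] by (auto simp: digit_vectors_def PiE_iff intro!: index_cong)
qed

lemma digit_eqI:
  assumes "x < prod_list ds" "y < prod_list ds" "\<And>i. i < length ds \<Longrightarrow> digit ds x i = digit ds y i"
  shows "x = y"
  using assms index_cong[of ds "digit ds x" "digit ds y"] by (simp add: index_digit)

lemma sum_digit_vectors:
  "(\<Sum>x<prod_list ds. F x) = (\<Sum>f\<in>digit_vectors ds. F (index ds f))"
  using sum.reindex_bij_betw[OF bij_betw_index, of F ds] by simp

lemma sum_digit_vectors_split:
  assumes i: "i < length ds"
  shows "(\<Sum>f\<in>digit_vectors ds. F f) =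
    (\<Sum>g\<in>(\<Pi>\<^sub>E j\<in>{..<length ds} - {i}. {..<ds ! j}). \<Sum>x<ds ! i. F (g(i := x)))"
proof -
  let ?I = "{..<length ds} - {i}"
  let ?G = "\<Pi>\<^sub>E j\<in>?I. {..<ds ! j}"
  have "digit_vectors ds = (\<Pi>\<^sub>E j\<in>insert i ?I. {..<ds ! j})"
    using i by (simp add: digit_vectors_def insert_absorb)
  also have "\<dots> = (\<lambda>(x, g). g(i := x)) ` ({..<ds ! i} \<times> ?G)"
    by (rule PiE_insert_eq)
  finally have "(\<Sum>f\<in>digit_vectors ds. F f) = (\<Sum>(x, g)\<in>{..<ds ! i} \<times> ?G. F (g(i := x)))"
    using inj_combinator[of i ?I "\<lambda>j. {..<ds ! j}"]
    by (simp add: sum.reindex case_prod_beta')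
  also have "\<dots> = (\<Sum>x<ds ! i. \<Sum>g\<in>?G. F (g(i := x)))"
    by (rule sum.cartesian_product[symmetric])
  also have "\<dots> = (\<Sum>g\<in>?G. \<Sum>x<ds ! i. F (g(i := x)))"
    by (rule sum.swap)
  finally show ?thesis .
qed

section \<open>Partial transposition\<close>

definition mix :: "nat set \<Rightarrow> (nat \<Rightarrow> nat) \<Rightarrow> (nat \<Rightarrow> nat) \<Rightarrow> nat \<Rightarrow> nat" where
  "mix S f g i = (if i \<in> S then g i else f i)"

lemma mix_empty [simp]: "mix {} f g = f"
  by (simp add: fun_eq_iff mix_def)

lemma mix_compl: "mix (- S) f g = mix S g f"
  by (auto simp: fun_eq_iff mix_def)

definition partial_transpose :: "nat set \<Rightarrow> nat list \<Rightarrow> complex mat \<Rightarrow> nat \<Rightarrow> nat \<Rightarrow> complex" where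
  "partial_transpose S ds \<rho> a b =
    \<rho> $$ (index ds (mix S (digit ds a) (digit ds b)), index ds (mix S (digit ds b) (digit ds a)))"

definition ppt :: "nat set \<Rightarrow> nat list \<Rightarrow> complex mat \<Rightarrow> bool" where
  "ppt S ds \<rho> \<longleftrightarrow> psd_on {..<prod_list ds} (partial_transpose S ds \<rho>)"

lemma index_mix_less:
  "a < prod_list ds \<Longrightarrow> b < prod_list ds \<Longrightarrow> index ds (mix S (digit ds a) (digit ds b)) < prod_list ds"
  by (rule index_less) (simp add: mix_def digit_less)

lemma digit_index_mix:
  assumes "a < prod_list ds" "b < prod_list ds" "i < length ds"
  shows "digit ds (index ds (mix S (digit ds a) (digit ds b))) i = mix S (digit ds a) (digit ds b) i"
  using assms by (intro digit_index) (simp_all add: mix_def digit_less)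

lemma ppt_empty_iff:
  assumes "\<rho> \<in> carrier_mat (prod_list ds) (prod_list ds)"
  shows "ppt {} ds \<rho> \<longleftrightarrow> positive_semidef \<rho>"
  unfolding positive_semidef_iff[OF assms] ppt_def
  by (rule psd_on_cong) (simp add: partial_transpose_def index_digit)

text \<open>Transposing the complementary parties is the full transpose of transposing those in
  \<open>S\<close>, and a full transpose keeps positivity. The complement is taken in all naturals,
  but only positions of \<open>ds\<close> are ever read.\<close>

lemma ppt_compl: "ppt S ds \<rho> \<Longrightarrow> ppt (- S) ds \<rho>"
proof -
  have "partial_transpose (- S) ds \<rho> = (\<lambda>a b. partial_transpose S ds \<rho> b a)"
    by (simp add: fun_eq_iff partial_transpose_def mix_compl)
  then show "ppt S ds \<rho> \<Longrightarrow> ppt (- S) ds \<rho>"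
    unfolding ppt_def using psd_on_swap by metis
qed

section \<open>Blocks of an operator and local operations\<close>

definition block :: "nat list \<Rightarrow> nat \<Rightarrow> complex mat \<Rightarrow> (nat \<Rightarrow> nat) \<Rightarrow> (nat \<Rightarrow> nat) \<Rightarrow> complex mat" where
  "block ds i \<rho> f g =
    mat (ds ! i) (ds ! i) (\<lambda>(x, y). \<rho> $$ (index ds (f(i := x)), index ds (g(i := y))))"

lemma block_carrier [simp]: "block ds i \<rho> f g \<in> carrier_mat (ds ! i) (ds ! i)"
  by (simp add: block_def)

lemma block_cong:
  assumes "\<And>j. j < length ds \<Longrightarrow> j \<noteq> i \<Longrightarrow> f j = f' j" "\<And>j. j < length ds \<Longrightarrow> j \<noteq> i \<Longrightarrow> g j = g' j"
  shows "block ds i \<rho> f g = block ds i \<rho> f' g'"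
proof -
  have "index ds (f(i := x)) = index ds (f'(i := x))" "index ds (g(i := x)) = index ds (g'(i := x))" for x
    using assms by (auto intro!: index_cong)
  then show ?thesis by (simp add: block_def)
qed

lemma local_map_carrier [simp]:
  "local_map ds i d' E \<rho> \<in> carrier_mat (prod_list (ds[i := d'])) (prod_list (ds[i := d']))"
  by (simp add: local_map_def Let_def)

lemma local_map_index:
  fixes ds i d' defines "es \<equiv> ds[i := d']"
  assumes "a < prod_list es" "b < prod_list es"
  shows "local_map ds i d' E \<rho> $$ (a, b) =
    E (block ds i \<rho> (digit es a) (digit es b)) $$ (digit es a i, digit es b i)"
  using assms by (simp add: local_map_def block_def Let_def)

lemma mult_add_less_mult:
  assumes "c < m" "z < d" shows "c * d + z < m * (d :: nat)"
proof -
  have "Suc c * d \<le> m * d" using assms(1) by (intro mult_right_mono) auto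
  with assms(2) show ?thesis by simp
qed

lemma digit_pair:
  assumes "c < m" "z < d"
  shows "digit [m, d] (c * d + z) 0 = c" "digit [m, d] (c * d + z) (Suc 0) = z"
  using assms by (simp_all add: digit_def)

text \<open>Indexing the ancilla in the definition of complete positivity by all basis vectors of the
  target space, rather than by those of the spectator parties only, makes both
  \<open>id \<otimes> E\<close> on an arbitrary tensor factor and its commutation with a transposition of
  spectators a matter of pulling back kernels.\<close>

lemma ppt_local_map_notin:
  assumes i: "i < length ds" "i \<notin> S" and cp: "completely_positive (ds ! i) d' E"
    and ppt: "ppt S ds \<rho>"
  shows "ppt S (ds[i := d']) (local_map ds i d' E \<rho>)"
proof -
  define es where "es = ds[i := d']"
  define m where "m = prod_list es"
  define d where "d = ds ! i"
  have len: "length es = length ds" and es: "es ! i = d'" "\<And>j. j \<noteq> i \<Longrightarrow> es ! j = ds ! j"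
    using i by (simp_all add: es_def)
  define K where "K = partial_transpose S ds \<rho>"
  \<comment> \<open>A number \<open>u < m * d\<close> encodes an ancilla vector
    \<open>u div d\<close>, which is a basis vector of the target space, and an input digit
    \<open>u mod d\<close> for party \<open>i\<close>. The map \<open>h\<close> overwrites digit
    \<open>i\<close> of the former by the latter.\<close>
  define h where "h = (\<lambda>u. index ds ((digit es (u div d))(i := u mod d)))"
  define X where "X = mat (m * d) (m * d) (\<lambda>(u, v). K (h u) (h v))"
  have upd: "((digit es a)(i := x)) j < ds ! j" if "a < m" "x < d" "j < length ds" for a x j
    using that digit_less[of a es j] len es(2) by (auto simp: m_def d_def)
  have h_less: "h u < prod_list ds" if "u < m * d" for u
  proof -
    have "u div d < m" "u mod d < d"
      using that by (simp add: less_mult_imp_div_less, cases "d = 0") simp_all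
    then show ?thesis unfolding h_def by (intro index_less upd)
  qed
  have "psd_on {..<m * d} (\<lambda>u v. K (h u) (h v))"
    using h_less ppt[unfolded ppt_def, folded K_def]
    by (intro psd_on_pullback[where f = h and K = K and B = "{..<prod_list ds}"]) auto
  then have "positive_semidef X"
    using positive_semidef_iff[of X "m * d"] psd_on_cong[of "{..<m * d}" "\<lambda>u v. K (h u) (h v)" "kernel_of X"]
    by (simp add: X_def)
  then have psdY: "psd_on {..<m * d'} (kernel_of (local_map [m, d] 1 d' E X))"
    using cp positive_semidef_iff[of "local_map [m, d] 1 d' E X" "m * d'"]
      local_map_carrier[of "[m, d]" 1 d' E X]
    by (simp add: completely_positive_def X_def d_def)
  have k_less: "a * d' + digit es a i < m * d'" if "a < m" for a
    using that digit_less[of a es i] i es len by (intro mult_add_less_mult) (auto simp: m_def)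
  \<comment> \<open>The ancilla already carries an output digit at \<open>i\<close>. This pullback
    keeps the entries in which the output of \<open>E\<close> agrees with that digit.\<close>
  have psd: "psd_on {..<m} (\<lambda>a b. local_map [m, d] 1 d' E X $$ (a * d' + digit es a i, b * d' + digit es b i))"
    by (rule psd_on_pullback[OF psdY]) (use k_less in auto)
  have dig: "digit [m, d'] (a * d' + digit es a i) 0 = a" "digit [m, d'] (a * d' + digit es a i) (Suc 0) = digit es a i"
    if "a < m" for a
    using that digit_less[of a es i] i es len
    by (auto simp: m_def intro!: digit_pair)
  have "partial_transpose S es (local_map ds i d' E \<rho>) a b =
      local_map [m, d] 1 d' E X $$ (a * d' + digit es a i, b * d' + digit es b i)"
    if ab: "a < m" "b < m" for a b
  proof -
    define a' where "a' = index es (mix S (digit es a) (digit es b))"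
    define b' where "b' = index es (mix S (digit es b) (digit es a))"
    have a'b': "a' < m" "b' < m"
      using ab by (simp_all add: a'_def b'_def m_def index_mix_less)
    have dig': "digit es a' j = mix S (digit es a) (digit es b) j"
        "digit es b' j = mix S (digit es b) (digit es a) j" if "j < length ds" for j
      using ab that by (simp_all add: a'_def b'_def m_def digit_index_mix len)
    \<comment> \<open>Both blocks overwrite digit \<open>i\<close>, and mixing leaves it alone
      because \<open>i\<close> is not in \<open>S\<close>; hence \<open>E\<close> receives the same
      operator on both sides.\<close>
    have "block [m, d] 1 X (digit [m, d'] (a * d' + digit es a i)) (digit [m, d'] (b * d' + digit es b i))
        = block ds i \<rho> (digit es a') (digit es b')" (is "?L = ?R")
    proof (rule eq_matI)
      fix x y assume "x < dim_row ?R" "y < dim_col ?R"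
      then have xy: "x < d" "y < d" by (simp_all add: block_def d_def)
      have "?L $$ (x, y) = X $$ (a * d + x, b * d + y)"
        using xy dig ab by (simp add: block_def index_Cons)
      also have "\<dots> = K (index ds ((digit es a)(i := x))) (index ds ((digit es b)(i := y)))"
        using xy ab by (simp add: X_def h_def mult_add_less_mult)
      also have "\<dots> = \<rho> $$ (index ds ((digit es a')(i := x)), index ds ((digit es b')(i := y)))"
      proof -
        have dd: "digit ds (index ds ((digit es c)(i := z))) j = ((digit es c)(i := z)) j"
          if "c < m" "z < d" "j < length ds" for c z j
          by (rule digit_index[OF upd[OF that(1,2)] that(3)])
        show ?thesis
          unfolding K_def partial_transpose_def
          by (intro arg_cong2[where f = "\<lambda>u v. \<rho> $$ (u, v)"] index_cong)
            (use i ab xy in \<open>auto simp: dd dig' mix_def\<close>)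
      qed
      also have "\<dots> = ?R $$ (x, y)" using xy by (simp add: block_def d_def)
      finally show "?L $$ (x, y) = ?R $$ (x, y)" .
    qed (simp_all add: block_def d_def)
    moreover have "partial_transpose S es (local_map ds i d' E \<rho>) a b =
        E (block ds i \<rho> (digit es a') (digit es b')) $$ (digit es a i, digit es b i)"
      using a'b' dig'[OF i(1)] i(2) local_map_index[of a' ds i d' b' E \<rho>]
      by (simp add: partial_transpose_def a'_def[symmetric] b'_def[symmetric] es_def[symmetric] m_def mix_def)
    moreover have "local_map [m, d] 1 d' E X $$ (a * d' + digit es a i, b * d' + digit es b i) =
        E (block [m, d] 1 X (digit [m, d'] (a * d' + digit es a i)) (digit [m, d'] (b * d' + digit es b i)))
          $$ (digit es a i, digit es b i)"
      using ab k_less dig local_map_index[of "a * d' + digit es a i" "[m, d]" 1 d' "b * d' + digit es b i" E X]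
      by simp
    ultimately show ?thesis by simp
  qed
  then show ?thesis
    using psd unfolding ppt_def es_def[symmetric] m_def[symmetric]
    by (subst psd_on_cong) auto
qed

lemma ppt_local_map:
  assumes "i < length ds" "completely_positive (ds ! i) d' E" "ppt S ds \<rho>"
  shows "ppt S (ds[i := d']) (local_map ds i d' E \<rho>)"
proof (cases "i \<in> S")
  case True
  then show ?thesis
    using ppt_compl[OF ppt_local_map_notin[OF assms(1) _ assms(2) ppt_compl[OF assms(3)]]] by simp
qed (use ppt_local_map_notin assms in blast)

section \<open>Trace and partial transposes along a protocol\<close>

lemma trace_eq_sum_diag: "\<rho> \<in> carrier_mat n n \<Longrightarrow> trace \<rho> = (\<Sum>a<n. \<rho> $$ (a, a))"
  by (auto simp: trace_def)

text \<open>Each configuration \<open>g\<close> of the other parties contributes one diagonal block,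
  so the trace condition of an instrument can be applied block by block.\<close>

lemma trace_local_map:
  assumes i: "i < length ds" and E: "\<And>f. E (block ds i \<rho> f f) \<in> carrier_mat d' d'"
  shows "trace (local_map ds i d' E \<rho>) =
    (\<Sum>g\<in>(\<Pi>\<^sub>E j\<in>{..<length ds} - {i}. {..<ds ! j}). trace (E (block ds i \<rho> g g)))"
proof -
  define es where "es = ds[i := d']"
  have len: "length es = length ds" and es: "es ! i = d'" "\<And>j. j \<noteq> i \<Longrightarrow> es ! j = ds ! j"
    using i by (simp_all add: es_def)
  have G: "(\<Pi>\<^sub>E j\<in>{..<length ds} - {i}. {..<es ! j}) = (\<Pi>\<^sub>E j\<in>{..<length ds} - {i}. {..<ds ! j})"
    by (rule PiE_cong) (simp add: es(2))
  have "trace (local_map ds i d' E \<rho>) = (\<Sum>a<prod_list es. local_map ds i d' E \<rho> $$ (a, a))"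
    using local_map_carrier[of ds i d' E \<rho>] by (simp add: trace_eq_sum_diag es_def)
  also have "\<dots> = (\<Sum>f\<in>digit_vectors es. local_map ds i d' E \<rho> $$ (index es f, index es f))"
    by (rule sum_digit_vectors)
  also have "\<dots> = (\<Sum>f\<in>digit_vectors es. E (block ds i \<rho> f f) $$ (f i, f i))"
  proof (rule sum.cong[OF refl])
    fix f assume "f \<in> digit_vectors es"
    then have f: "\<And>j. j < length es \<Longrightarrow> f j < es ! j" by (auto simp: digit_vectors_def PiE_iff)
    have "block ds i \<rho> (digit es (index es f)) (digit es (index es f)) = block ds i \<rho> f f"
      using digit_index[OF f] len by (intro block_cong) auto
    then show "local_map ds i d' E \<rho> $$ (index es f, index es f) = E (block ds i \<rho> f f) $$ (f i, f i)"
      using index_less[OF f] digit_index[OF f, of i] i len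
      by (simp add: local_map_index es_def[symmetric])
  qed
  also have "\<dots> = (\<Sum>g\<in>(\<Pi>\<^sub>E j\<in>{..<length ds} - {i}. {..<ds ! j}). \<Sum>x<d'.
      E (block ds i \<rho> (g(i := x)) (g(i := x))) $$ (x, x))"
    using sum_digit_vectors_split[of i es "\<lambda>f. E (block ds i \<rho> f f) $$ (f i, f i)"] i len
    by (simp add: G es(1))
  also have "\<dots> = (\<Sum>g\<in>(\<Pi>\<^sub>E j\<in>{..<length ds} - {i}. {..<ds ! j}). trace (E (block ds i \<rho> g g)))"
  proof (rule sum.cong[OF refl])
    fix g
    have "block ds i \<rho> (g(i := x)) (g(i := x)) = block ds i \<rho> g g" for x
      by (rule block_cong) auto
    then show "(\<Sum>x<d'. E (block ds i \<rho> (g(i := x)) (g(i := x))) $$ (x, x)) = trace (E (block ds i \<rho> g g))"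
      using trace_eq_sum_diag[OF E] by simp
  qed
  finally show ?thesis .
qed

lemma trace_instrument:
  assumes i: "i < length ds" and inst: "instrument (ds ! i) d' m E"
    and \<rho>: "\<rho> \<in> carrier_mat (prod_list ds) (prod_list ds)"
  shows "(\<Sum>j<m. trace (local_map ds i d' (E j) \<rho>)) = trace \<rho>"
proof -
  let ?G = "\<Pi>\<^sub>E j\<in>{..<length ds} - {i}. {..<ds ! j}"
  have E: "E j (block ds i \<rho> f f) \<in> carrier_mat d' d'" if "j < m" for j f
    using inst that by (auto simp: instrument_def completely_positive_def linear_op_def)
  have "(\<Sum>j<m. trace (local_map ds i d' (E j) \<rho>)) = (\<Sum>j<m. \<Sum>g\<in>?G. trace (E j (block ds i \<rho> g g)))"
    by (intro sum.cong refl trace_local_map i E) auto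
  also have "\<dots> = (\<Sum>g\<in>?G. \<Sum>j<m. trace (E j (block ds i \<rho> g g)))"
    by (rule sum.swap)
  also have "\<dots> = (\<Sum>g\<in>?G. trace (block ds i \<rho> g g))"
    using inst by (simp add: instrument_def)
  also have "\<dots> = (\<Sum>g\<in>?G. \<Sum>x<ds ! i. \<rho> $$ (index ds (g(i := x)), index ds (g(i := x))))"
    by (simp add: trace_def block_def)
  also have "\<dots> = (\<Sum>f\<in>digit_vectors ds. \<rho> $$ (index ds f, index ds f))"
    by (rule sum_digit_vectors_split[OF i, symmetric])
  also have "\<dots> = trace \<rho>"
    by (simp add: trace_eq_sum_diag[OF \<rho>] sum_digit_vectors)
  finally show ?thesis .
qed

text \<open>The statement is about arbitrary operators rather than states, because the input of a
  single branch is not normalized: only the sum of the traces over the outcomes is preserved by an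
  instrument. The carrier is part of the induction as the summation of traces over the branches
  relies on it.\<close>

lemma locc_preserves:
  assumes "locc ds ds' \<Lambda>" "\<rho> \<in> carrier_mat (prod_list ds) (prod_list ds)"
  shows "\<Lambda> \<rho> \<in> carrier_mat (prod_list ds') (prod_list ds') \<and> trace (\<Lambda> \<rho>) = trace \<rho> \<and>
    (ppt S ds \<rho> \<longrightarrow> ppt S ds' (\<Lambda> \<rho>))"
  using assms
proof (induction arbitrary: \<rho> rule: locc.induct)
  case (finish ds)
  then show ?case by simp
next
  case (step i ds d' m E ds' L)
  define N where "N = prod_list ds'"
  define \<tau> where "\<tau> = (\<lambda>j. L j (local_map ds i d' (E j) \<rho>))"
  have IH: "\<tau> j \<in> carrier_mat N N" "trace (\<tau> j) = trace (local_map ds i d' (E j) \<rho>)"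
    "ppt S (ds[i := d']) (local_map ds i d' (E j) \<rho>) \<Longrightarrow> ppt S ds' (\<tau> j)" if "j < m" for j
    using step.IH[OF that local_map_carrier] by (auto simp: N_def \<tau>_def)
  let ?\<sigma> = "mat N N (\<lambda>ab. \<Sum>j<m. \<tau> j $$ ab)"
  have "trace ?\<sigma> = (\<Sum>j<m. \<Sum>a<N. \<tau> j $$ (a, a))"
    by (simp add: trace_def) (rule sum.swap)
  also have "\<dots> = (\<Sum>j<m. trace (local_map ds i d' (E j) \<rho>))"
    by (intro sum.cong refl) (simp add: IH(2) flip: trace_eq_sum_diag[OF IH(1)])
  also have "\<dots> = trace \<rho>"
    by (rule trace_instrument[OF step.hyps(1,2) step.prems])
  finally have "trace ?\<sigma> = trace \<rho>" .
  moreover have "ppt S ds' ?\<sigma>" if "ppt S ds \<rho>"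
  proof -
    have "ppt S ds' (\<tau> j)" if "j < m" for j
      using step.hyps(1,2) that \<open>ppt S ds \<rho>\<close> by (intro IH(3) ppt_local_map) (auto simp: instrument_def)
    then have "psd_on {..<N} (\<lambda>a b. \<Sum>j<m. partial_transpose S ds' (\<tau> j) a b)"
      by (intro psd_on_sum) (auto simp: ppt_def N_def)
    then show ?thesis
      unfolding ppt_def N_def[symmetric]
      by (subst psd_on_cong) (auto simp: partial_transpose_def N_def index_mix_less)
  qed
  ultimately show ?case by (simp add: N_def \<tau>_def)
qed

section \<open>Tensor powers of states\<close>

text \<open>A Hermitian root \<open>B\<close> of \<open>K\<close> expands the entries of
  \<open>K\<close> into a sum of rank-one kernels, and each of these acts on \<open>L\<close> by a
  diagonal congruence.\<close>

lemma psd_on_schur_product: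
  fixes n :: nat
  assumes K: "psd_on {..<n} K" and f: "\<And>x. x \<in> A \<Longrightarrow> f x < n" and L: "psd_on A L"
  shows "psd_on A (\<lambda>x y. K (f x) (f y) * L x y)"
proof -
  define M where "M = mat n n (\<lambda>(x, y). K x y)"
  have M: "M \<in> carrier_mat n n" by (simp add: M_def)
  have "psd_on {..<n} (kernel_of M)"
    by (rule psd_on_cong[THEN iffD1, OF _ K]) (simp add: M_def)
  then obtain B where B: "B \<in> carrier_mat n n" "positive_semidef B" "B * B = M"
    using positive_semidef_sqrt_exists[of M n] positive_semidef_iff[OF M] M by blast
  have herm: "B $$ (z, y) = cnj (B $$ (y, z))" if "y < n" "z < n" for y z
    using psd_on_hermitian[of "{..<n}" "kernel_of B" y z] B positive_semidef_iff[OF B(1)] that by auto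
  have KB: "K x y = (\<Sum>z<n. B $$ (x, z) * cnj (B $$ (y, z)))" if "x < n" "y < n" for x y
  proof -
    have "K x y = (B * B) $$ (x, y)" using that by (simp add: B(3) M_def)
    also have "\<dots> = (\<Sum>z<n. B $$ (x, z) * B $$ (z, y))"
      using B(1) that by (simp add: scalar_prod_def atLeast0LessThan)
    also have "\<dots> = (\<Sum>z<n. B $$ (x, z) * cnj (B $$ (y, z)))"
      using herm[OF that(2)] by (intro sum.cong) auto
    finally show ?thesis .
  qed
  have "psd_on A (\<lambda>x y. \<Sum>z<n. B $$ (f x, z) * cnj (B $$ (f y, z)) * L x y)"
    by (intro psd_on_sum psd_on_rank_one_mult L)
  then show ?thesis
    by (rule psd_on_cong[THEN iffD1, rotated]) (simp add: KB f sum_distrib_right)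
qed

lemma psd_on_prod_pullback:
  fixes n :: nat
  assumes "psd_on {..<n} K" "finite A" "\<And>l x. l \<in> F \<Longrightarrow> x \<in> A \<Longrightarrow> f l x < n"
  shows "psd_on A (\<lambda>x y. \<Prod>l\<in>F. K (f l x) (f l y))"
  using assms(3)
proof (induction F rule: infinite_finite_induct)
  case (insert l F)
  then show ?case
    using psd_on_schur_product[OF assms(1), of A "f l" "\<lambda>x y. \<Prod>l\<in>F. K (f l x) (f l y)"] by simp
qed (simp_all add: psd_on_one[OF assms(2)])

lemma copy_index_less: "l < k \<Longrightarrow> copy_index n k l x < 2 ^ n"
  using index_less[of "qubits n"] by (simp add: copy_index_def digit_def)

lemma digit_copy_index:
  "l < k \<Longrightarrow> i < n \<Longrightarrow>
    digit (qubits n) (copy_index n k l x) i = digit (qubits k) (digit (replicate n (2 ^ k)) x i) l"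
  unfolding copy_index_def by (rule digit_index) (simp_all add: digit_def)

text \<open>Transposing a party transposes its qubit in every copy, that is,
  \<open>copy_index\<close> commutes with \<open>mix\<close>. So the partial transpose of the copies
  is an entrywise product of pullbacks of the partial transpose of one copy.\<close>

lemma ppt_copies:
  assumes "ppt S (qubits n) \<rho>"
  shows "ppt S (replicate n (2 ^ k)) (copies n k \<rho>)"
proof -
  define ds :: "nat list" where "ds = replicate n (2 ^ k)"
  let ?N = "(2 ^ k) ^ n :: nat"
  have N: "prod_list ds = ?N" by (simp add: ds_def)
  let ?K = "partial_transpose S (qubits n) \<rho>"
  have "psd_on {..<2 ^ n} ?K" using assms by (simp add: ppt_def)
  then have "psd_on {..<?N} (\<lambda>a b. \<Prod>l<k. ?K (copy_index n k l a) (copy_index n k l b))"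
    by (rule psd_on_prod_pullback) (auto intro: copy_index_less)
  moreover have "partial_transpose S ds (copies n k \<rho>) a b = (\<Prod>l<k. ?K (copy_index n k l a) (copy_index n k l b))"
    if ab: "a < ?N" "b < ?N" for a b
  proof -
    have ci: "copy_index n k l (index ds (mix S (digit ds x) (digit ds y))) =
        index (qubits n) (mix S (digit (qubits n) (copy_index n k l x)) (digit (qubits n) (copy_index n k l y)))"
      if "l < k" "x < ?N" "y < ?N" for l x y
      unfolding copy_index_def[of n k l "index ds _"]
    proof (rule index_cong)
      fix i assume "i < length (qubits n)"
      then show "digit (qubits k) (digit (replicate n (2 ^ k)) (index ds (mix S (digit ds x) (digit ds y))) i) l
        = mix S (digit (qubits n) (copy_index n k l x)) (digit (qubits n) (copy_index n k l y)) i"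
        using that N digit_index_mix[of x ds y i S]
        by (simp add: mix_def digit_copy_index ds_def)
    qed
    show ?thesis
      using ab index_mix_less[of a ds b S] index_mix_less[of b ds a S] N
      by (simp add: partial_transpose_def copies_def ci)
  qed
  ultimately show ?thesis
    unfolding ppt_def ds_def[symmetric] N by (subst psd_on_cong) auto
qed

text \<open>Regrouping qubits by copies instead of parties permutes the basis, which lets the trace
  of the copies factor. Digits give injectivity, and counting gives the rest.\<close>

lemma bij_betw_copy_index:
  "bij_betw (\<lambda>x. \<lambda>l\<in>{..<k}. copy_index n k l x) {..<(2 ^ k) ^ n} (\<Pi>\<^sub>E l\<in>{..<k}. {..<2 ^ n})"
proof -
  let ?f = "\<lambda>x. \<lambda>l\<in>{..<k}. copy_index n k l x"
  let ?ds = "replicate n (2 ^ k) :: nat list"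
  have inj: "inj_on ?f {..<(2 ^ k) ^ n}"
  proof (rule inj_onI)
    fix x y assume xy: "x \<in> {..<(2 ^ k) ^ n}" "y \<in> {..<(2 ^ k) ^ n}" and eq: "?f x = ?f y"
    have ci: "copy_index n k l x = copy_index n k l y" if "l < k" for l
      using fun_cong[OF eq, of l] that by simp
    show "x = y"
    proof (rule digit_eqI[of _ ?ds])
      fix i assume "i < length ?ds"
      then have i: "i < n" by simp
      show "digit ?ds x i = digit ?ds y i"
      proof (rule digit_eqI[of _ "qubits k"])
        show "digit (qubits k) (digit ?ds x i) l = digit (qubits k) (digit ?ds y i) l" if "l < length (qubits k)" for l
          using ci[of l] digit_copy_index[of l k i n] i that by (metis length_replicate)
      qed (use digit_less[of x ?ds i] digit_less[of y ?ds i] xy i in auto)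
    qed (use xy in auto)
  qed
  have "?f ` {..<(2 ^ k) ^ n} \<subseteq> (\<Pi>\<^sub>E l\<in>{..<k}. {..<2 ^ n})"
    by (intro image_subsetI) (auto simp: PiE_iff copy_index_less)
  moreover have "card (?f ` {..<(2 ^ k) ^ n}) = card (\<Pi>\<^sub>E l\<in>{..<k}. {..<2 ^ n :: nat})"
    unfolding card_image[OF inj] by (simp add: card_PiE mult.commute flip: power_mult)
  ultimately have "?f ` {..<(2 ^ k) ^ n} = (\<Pi>\<^sub>E l\<in>{..<k}. {..<2 ^ n})"
    by (intro card_subset_eq) (auto intro: finite_PiE)
  with inj show ?thesis by (simp add: bij_betw_def)
qed

lemma trace_copies:
  assumes "\<rho> \<in> carrier_mat (2 ^ n) (2 ^ n)"
  shows "trace (copies n k \<rho>) = trace \<rho> ^ k"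
proof -
  have "trace (copies n k \<rho>) =
      (\<Sum>x<(2 ^ k) ^ n. \<Prod>l<k. \<rho> $$ (copy_index n k l x, copy_index n k l x))"
    by (simp add: trace_def copies_def)
  also have "\<dots> = (\<Sum>f\<in>(\<Pi>\<^sub>E l\<in>{..<k}. {..<2 ^ n}). \<Prod>l<k. \<rho> $$ (f l, f l))"
    by (subst sum.reindex_bij_betw[OF bij_betw_copy_index, symmetric]) simp
  also have "\<dots> = (\<Prod>l<k. \<Sum>a<2 ^ n. \<rho> $$ (a, a))"
    by (rule prod_sum_PiE[symmetric]) auto
  also have "\<dots> = trace \<rho> ^ k"
    by (simp add: trace_eq_sum_diag[OF assms])
  finally show ?thesis .
qed

section \<open>The noisy GHZ state\<close>

abbreviation const_index :: "nat \<Rightarrow> nat \<Rightarrow> nat" where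
  "const_index n s \<equiv> index (qubits n) (\<lambda>_. s)"

lemma const_index_less: "s < 2 \<Longrightarrow> const_index n s < 2 ^ n"
  using index_less[of "qubits n" "\<lambda>_. s"] by simp

lemma digit_const_index: "s < 2 \<Longrightarrow> i < n \<Longrightarrow> digit (qubits n) (const_index n s) i = s"
  by (rule digit_index) auto

lemma ghz_vec_carrier: "ghz_vec n \<in> carrier_vec (2 ^ n)"
  by (simp add: ghz_vec_def)

lemma ghz_vec_index:
  "x < 2 ^ n \<Longrightarrow> ghz_vec n $ x =
    complex_of_real (1 / sqrt 2) * (of_bool (x = const_index n 0) + of_bool (x = const_index n 1))"
  using const_index_less[of 0 n] const_index_less[of 1 n] by (simp add: ghz_vec_def unit_vec_def)

lemma ghz_eq_outer: "ghz n = outer (2 ^ n) (ghz_vec n)"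
  by (simp add: ghz_def outer_def)

lemma sum_lessThan_2: "(\<Sum>s<2. f s) = f 0 + f (1 :: nat)"
  by (simp add: numeral_2_eq_2)

text \<open>Serves twice: for the output of the channel and for the overlap with the GHZ state.
  Adding two indicators, instead of distinguishing cases, keeps it valid for \<open>n = 0\<close>,
  where the constant strings coincide.\<close>

lemma sum_ghz:
  fixes G :: "nat \<Rightarrow> nat \<Rightarrow> complex"
  shows "(\<Sum>x<2 ^ n. \<Sum>y<2 ^ n. ghz_vec n $ x * cnj (ghz_vec n $ y) * G x y) =
    (\<Sum>s<2. \<Sum>t<2. G (const_index n s) (const_index n t)) / 2"
proof -
  define r where "r = complex_of_real (1 / sqrt 2)"
  define u :: "nat \<Rightarrow> complex" where
    "u = (\<lambda>x. of_bool (x = const_index n 0) + of_bool (x = const_index n 1))"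
  have u: "(\<Sum>x<2 ^ n. u x * H x) = (\<Sum>s<2. H (const_index n s))" for H :: "nat \<Rightarrow> complex"
  proof -
    have "(\<Sum>x<2 ^ n. u x * H x) = (\<Sum>x<2 ^ n. if x = const_index n 0 then H x else 0) +
        (\<Sum>x<2 ^ n. if x = const_index n 1 then H x else 0)"
      unfolding sum.distrib[symmetric] by (intro sum.cong refl) (simp add: u_def)
    then show ?thesis
      using const_index_less[of 0 n] const_index_less[of 1 n] by (simp add: sum_lessThan_2)
  qed
  have rr: "r * r = 1 / 2" by (simp add: r_def flip: of_real_mult)
  have "(\<Sum>x<2 ^ n. \<Sum>y<2 ^ n. ghz_vec n $ x * cnj (ghz_vec n $ y) * G x y)
      = (\<Sum>x<2 ^ n. \<Sum>y<2 ^ n. r * r * (u x * (u y * G x y)))"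
  proof (intro sum.cong refl)
    fix x y assume "x \<in> {..<2 ^ n :: nat}" "y \<in> {..<2 ^ n :: nat}"
    then have "ghz_vec n $ x = r * u x" "cnj (ghz_vec n $ y) = r * u y"
      by (simp_all add: ghz_vec_index r_def u_def)
    then show "ghz_vec n $ x * cnj (ghz_vec n $ y) * G x y = r * r * (u x * (u y * G x y))"
      by simp
  qed
  also have "\<dots> = (\<Sum>s<2. \<Sum>t<2. G (const_index n s) (const_index n t)) / 2"
    unfolding sum_distrib_left[symmetric] u rr by simp
  finally show ?thesis .
qed

section \<open>Matrix entries of the noisy state\<close>

abbreviation noisy_ghz :: "nat \<Rightarrow> real \<Rightarrow> complex mat" where
  "noisy_ghz n p \<equiv> tensor_power_map n (teleport p) (ghz n)"

text \<open>The probability that the channel turns the basis state \<open>s\<close> into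
  \<open>u\<close>.\<close>

definition flip_weight :: "real \<Rightarrow> nat \<Rightarrow> nat \<Rightarrow> real" where
  "flip_weight p s u = (if u = s then (1 + p) / 2 else (1 - p) / 2)"

lemma teleport_matrix_unit_index:
  assumes "s < 2" "t < 2" "u < 2" "v < 2"
  shows "teleport p (matrix_unit 2 s t) $$ (u, v) =
    (if s = t then of_bool (u = v) * complex_of_real (flip_weight p s u)
     else of_bool (u = s \<and> v = t) * complex_of_real p)"
  unfolding teleport_matrix_unit[OF assms(1,2)] using assms
  by (auto simp: matrix_unit_def flip_weight_def field_simps)

definition diag_weight :: "nat \<Rightarrow> real \<Rightarrow> nat \<Rightarrow> real" where
  "diag_weight n p a =
    ((\<Prod>i<n. flip_weight p 0 (digit (qubits n) a i)) + (\<Prod>i<n. flip_weight p 1 (digit (qubits n) a i))) / 2"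

lemma digit_qubits_less [simp]: "i < n \<Longrightarrow> digit (qubits n) a i < 2"
  by (simp add: digit_def)

lemma prod_of_bool: "finite A \<Longrightarrow> (\<Prod>i\<in>A. of_bool (P i) :: 'a :: comm_semiring_1) = of_bool (\<forall>i\<in>A. P i)"
  by (induction A rule: finite_induct) auto

text \<open>The GHZ state has four terms. The two diagonal ones become product distributions; in the
  other two every qubit keeps its matrix unit and contributes a factor \<open>p\<close>, so the
  coherence stays in place with weight \<open>p ^ n / 2\<close>.\<close>

lemma noisy_ghz_index:
  assumes ab: "a < 2 ^ n" "b < 2 ^ n"
  shows "noisy_ghz n p $$ (a, b) = complex_of_real (of_bool (a = b) * diag_weight n p a + p ^ n / 2 *
    (of_bool (\<forall>i<n. digit (qubits n) a i = 0 \<and> digit (qubits n) b i = 1)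
      + of_bool (\<forall>i<n. digit (qubits n) a i = 1 \<and> digit (qubits n) b i = 0)))"
proof -
  define T where "T = (\<lambda>s t. \<Prod>i<n. teleport p (matrix_unit 2 s t) $$ (digit (qubits n) a i, digit (qubits n) b i))"
  have "noisy_ghz n p $$ (a, b) = (\<Sum>x<2 ^ n. \<Sum>y<2 ^ n. ghz_vec n $ x * cnj (ghz_vec n $ y) *
      (\<Prod>i<n. teleport p (matrix_unit 2 (digit (qubits n) x i) (digit (qubits n) y i))
        $$ (digit (qubits n) a i, digit (qubits n) b i)))"
    using ab by (simp add: tensor_power_map_def ghz_def)
  also have "\<dots> = (\<Sum>s<2. \<Sum>t<2. T s t) / 2"
    unfolding sum_ghz T_def
    by (intro arg_cong[where f = "\<lambda>z. z / 2"] sum.cong prod.cong refl) (simp add: digit_const_index)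
  finally have eq: "noisy_ghz n p $$ (a, b) = (T 0 0 + T 0 1 + T 1 0 + T 1 1) / 2"
    by (simp add: sum_lessThan_2 algebra_simps)
  have eq_iff: "(\<forall>i\<in>{..<n}. digit (qubits n) a i = digit (qubits n) b i) \<longleftrightarrow> a = b"
    using digit_eqI[of a "qubits n" b] ab by auto
  have "T s s = complex_of_real (of_bool (a = b) * (\<Prod>i<n. flip_weight p s (digit (qubits n) a i)))" if "s < 2" for s
  proof -
    have "T s s = (\<Prod>i<n. of_bool (digit (qubits n) a i = digit (qubits n) b i) *
        complex_of_real (flip_weight p s (digit (qubits n) a i)))"
      unfolding T_def using that by (intro prod.cong) (simp_all add: teleport_matrix_unit_index)
    then show ?thesis
      by (simp only: prod.distrib prod_of_bool finite_lessThan eq_iff of_real_mult of_real_prod)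
        (cases "a = b"; simp)
  qed
  moreover have "T s t = complex_of_real (of_bool (\<forall>i<n. digit (qubits n) a i = s \<and> digit (qubits n) b i = t) * p ^ n)"
    if "s < 2" "t < 2" "s \<noteq> t" for s t
  proof -
    have "T s t = (\<Prod>i<n. of_bool (digit (qubits n) a i = s \<and> digit (qubits n) b i = t) * complex_of_real p)"
      unfolding T_def using that by (intro prod.cong) (simp_all add: teleport_matrix_unit_index)
    also have "\<dots> = of_bool (\<forall>i\<in>{..<n}. digit (qubits n) a i = s \<and> digit (qubits n) b i = t) * complex_of_real p ^ n"
      by (simp only: prod.distrib prod_of_bool finite_lessThan prod_constant card_lessThan)
    finally show ?thesis by (simp add: Ball_def)
  qed
  ultimately show ?thesis
    unfolding eq diag_weight_def by (cases "a = b") (simp_all add: field_simps)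
qed

lemma noisy_ghz_carrier [simp]: "noisy_ghz n p \<in> carrier_mat (2 ^ n) (2 ^ n)"
  by (simp add: tensor_power_map_def)

lemma trace_noisy_ghz:
  assumes "0 < n" shows "trace (noisy_ghz n p) = 1"
proof -
  have w: "(\<Sum>a<2 ^ n. \<Prod>i<n. flip_weight p s (digit (qubits n) a i)) = 1" if "s < 2" for s
  proof -
    have "(\<Sum>a<prod_list (qubits n). \<Prod>i<n. flip_weight p s (digit (qubits n) a i))
        = (\<Sum>f\<in>digit_vectors (qubits n). \<Prod>i<n. flip_weight p s (digit (qubits n) (index (qubits n) f) i))"
      by (rule sum_digit_vectors)
    also have "\<dots> = (\<Sum>f\<in>(\<Pi>\<^sub>E i\<in>{..<n}. {..<2}). \<Prod>i<n. flip_weight p s (f i))"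
    proof (rule sum.cong)
      fix f assume f: "f \<in> (\<Pi>\<^sub>E i\<in>{..<n}. {..<2 :: nat})"
      show "(\<Prod>i<n. flip_weight p s (digit (qubits n) (index (qubits n) f) i)) = (\<Prod>i<n. flip_weight p s (f i))"
        using f by (intro prod.cong arg_cong[where f = "flip_weight p s"] digit_index) (auto simp: PiE_iff)
    qed (auto simp: digit_vectors_def intro!: PiE_cong)
    also have "\<dots> = (\<Prod>i<n. \<Sum>u<2. flip_weight p s u)"
      by (rule prod_sum_PiE[symmetric]) auto
    also have "\<dots> = 1"
      using that by (intro prod.neutral) (auto simp: flip_weight_def sum_lessThan_2 field_simps)
    finally show ?thesis by simp
  qed
  have "noisy_ghz n p $$ (a, a) = complex_of_real (diag_weight n p a)" if "a < 2 ^ n" for a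
  proof -
    \<comment> \<open>The coherences lie off the diagonal only because \<open>n > 0\<close>.\<close>
    have no: "(\<forall>i<n. digit (qubits n) a i = u \<and> digit (qubits n) a i = v) \<longleftrightarrow> False" if "u \<noteq> v" for u v
      using assms that by auto
    show ?thesis
      unfolding noisy_ghz_index[OF that that] no[OF zero_neq_one] no[OF one_neq_zero] by simp
  qed
  then have "trace (noisy_ghz n p) = complex_of_real (\<Sum>a<2 ^ n. diag_weight n p a)"
    by (simp add: trace_eq_sum_diag[OF noisy_ghz_carrier])
  also have "(\<Sum>a<2 ^ n. diag_weight n p a) = 1"
    unfolding diag_weight_def by (simp add: sum.distrib w flip: sum_divide_distrib)
  finally show ?thesis by simp
qed

text \<open>Moving the amount \<open>c\<close> from the diagonal at \<open>x\<close> and at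
  \<open>y\<close> to the swap completes it to a rank-one kernel; the remaining diagonal
  \<open>R\<close> is nonnegative.\<close>

lemma psd_on_diagonal_plus_swap:
  assumes A: "finite A" "x \<in> A" "y \<in> A" "x \<noteq> y" and D: "\<And>a. a \<in> A \<Longrightarrow> 0 \<le> D a"
    and c: "0 \<le> c" "c \<le> D x" "c \<le> D y"
  shows "psd_on A (\<lambda>a b. complex_of_real (of_bool (a = b) * D a +
    c * (of_bool (a = x \<and> b = y) + of_bool (a = y \<and> b = x))))"
proof -
  define u :: "'a \<Rightarrow> real" where "u = (\<lambda>a. of_bool (a = x) + of_bool (a = y))"
  define R where "R = (\<lambda>a. D a - c * u a)"
  have R: "0 \<le> R a" if "a \<in> A" for a
    using D[OF that] c A(4) by (auto simp: R_def u_def)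
  have "psd_on A (\<lambda>a b. \<Sum>z\<in>A. (sqrt (R z) * of_bool (a = z)) * cnj (sqrt (R z) * of_bool (b = z)) * 1)"
    by (intro psd_on_sum psd_on_rank_one_mult psd_on_one A)
  moreover have "psd_on A (\<lambda>a b. (sqrt c * u a) * cnj (complex_of_real (sqrt c * u b)) * 1)"
    by (intro psd_on_rank_one_mult psd_on_one A)
  ultimately have "psd_on A (\<lambda>a b.
      (\<Sum>z\<in>A. (sqrt (R z) * of_bool (a = z)) * cnj (sqrt (R z) * of_bool (b = z)) * 1) +
      (sqrt c * u a) * cnj (complex_of_real (sqrt c * u b)) * 1)"
    by (rule psd_on_add)
  then show ?thesis
  proof (rule psd_on_cong[THEN iffD1, rotated])
    fix a b assume ab: "a \<in> A" "b \<in> A"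
    have "(\<Sum>z\<in>A. (sqrt (R z) * of_bool (a = z)) * cnj (sqrt (R z) * of_bool (b = z)) * (1 :: complex))
        = (\<Sum>z\<in>A. if z = a then of_bool (a = b) * complex_of_real (R a) else 0)"
      using R ab by (intro sum.cong) (auto simp flip: of_real_mult)
    also have "\<dots> = of_bool (a = b) * complex_of_real (R a)"
      using A ab by simp
    finally show "(\<Sum>z\<in>A. (sqrt (R z) * of_bool (a = z)) * cnj (sqrt (R z) * of_bool (b = z)) * 1) +
      (sqrt c * u a) * cnj (complex_of_real (sqrt c * u b)) * 1 =
      complex_of_real (of_bool (a = b) * D a + c * (of_bool (a = x \<and> b = y) + of_bool (a = y \<and> b = x)))"
      using c A(4) by (auto simp: R_def u_def of_bool_def simp flip: of_real_mult)
  qed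
qed

text \<open>Partial transposition on \<open>S\<close> moves the coherence between the constant
  strings to \<open>ind_index n S\<close> and \<open>ind_index n (- S)\<close>.\<close>

definition ind_index :: "nat \<Rightarrow> nat set \<Rightarrow> nat" where
  "ind_index n S = index (qubits n) (\<lambda>i. of_bool (i \<in> S))"

lemma ind_index_less: "ind_index n S < 2 ^ n"
  using index_less[of "qubits n" "\<lambda>i. of_bool (i \<in> S)"] by (simp add: ind_index_def)

lemma digit_ind_index: "i < n \<Longrightarrow> digit (qubits n) (ind_index n S) i = of_bool (i \<in> S)"
  unfolding ind_index_def by (rule digit_index) auto

lemma eq_ind_index_iff:
  "a < 2 ^ n \<Longrightarrow> a = ind_index n S \<longleftrightarrow> (\<forall>i<n. digit (qubits n) a i = of_bool (i \<in> S))"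
  using digit_eqI[of a "qubits n" "ind_index n S"] ind_index_less[of n S] by (auto simp: digit_ind_index)

text \<open>The product in the hypothesis is the weight of reaching the string of \<open>S\<close>
  from all zeros, and also that of reaching its complement from all ones. Half of it bounds both
  populations from below, while the displaced coherence is \<open>p ^ n / 2\<close>.\<close>

lemma ppt_noisy_ghz:
  assumes n: "0 < n" and p: "0 \<le> p" "p \<le> 1"
    and le: "p ^ n \<le> (\<Prod>i<n. if i \<in> S then (1 - p) / 2 else (1 + p) / 2)"
  shows "ppt S (qubits n) (noisy_ghz n p)"
proof -
  define s where "s = ind_index n S"
  define t where "t = ind_index n (- S)"
  have st: "s < 2 ^ n" "t < 2 ^ n" by (simp_all add: s_def t_def ind_index_less)
  have "s \<noteq> t"
    using n digit_ind_index[of 0 n S] digit_ind_index[of 0 n "- S"]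
    by (cases "0 \<in> S") (auto simp: s_def t_def)
  have w: "0 \<le> flip_weight p r u" for r u using p by (simp add: flip_weight_def)
  have "(\<Prod>i<n. if i \<in> S then (1 - p) / 2 else (1 + p) / 2) = (\<Prod>i<n. flip_weight p 0 (digit (qubits n) s i))"
    by (intro prod.cong) (auto simp: s_def digit_ind_index flip_weight_def)
  moreover have "(\<Prod>i<n. if i \<in> S then (1 - p) / 2 else (1 + p) / 2) = (\<Prod>i<n. flip_weight p 1 (digit (qubits n) t i))"
    by (intro prod.cong) (auto simp: t_def digit_ind_index flip_weight_def)
  moreover have "0 \<le> (\<Prod>i<n. flip_weight p r (digit (qubits n) a i))" for r a
    by (intro prod_nonneg w)
  ultimately have le_D: "p ^ n / 2 \<le> diag_weight n p s" "p ^ n / 2 \<le> diag_weight n p t"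
    "0 \<le> diag_weight n p a" for a
    using le by (simp_all add: diag_weight_def add_increasing add_increasing2)
  have "psd_on {..<2 ^ n} (\<lambda>a b. complex_of_real (of_bool (a = b) * diag_weight n p a +
      p ^ n / 2 * (of_bool (a = s \<and> b = t) + of_bool (a = t \<and> b = s))))"
    using st \<open>s \<noteq> t\<close> le_D p by (intro psd_on_diagonal_plus_swap) auto
  moreover have "partial_transpose S (qubits n) (noisy_ghz n p) a b =
      complex_of_real (of_bool (a = b) * diag_weight n p a +
      p ^ n / 2 * (of_bool (a = s \<and> b = t) + of_bool (a = t \<and> b = s)))"
    if ab: "a < 2 ^ n" "b < 2 ^ n" for a b
  proof -
    let ?d = "digit (qubits n)"
    define a' where "a' = index (qubits n) (mix S (?d a) (?d b))"
    define b' where "b' = index (qubits n) (mix S (?d b) (?d a))"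
    have less: "a' < 2 ^ n" "b' < 2 ^ n"
      using index_mix_less[of a "qubits n" b S] index_mix_less[of b "qubits n" a S] ab
      by (simp_all add: a'_def b'_def)
    have dig: "?d a' i = mix S (?d a) (?d b) i" "?d b' i = mix S (?d b) (?d a) i" if "i < n" for i
      using digit_index_mix[of a "qubits n" b i S] digit_index_mix[of b "qubits n" a i S] ab that
      by (simp_all add: a'_def b'_def)
    have "a' = b' \<longleftrightarrow> a = b"
    proof
      assume "a' = b'"
      then have "?d a i = ?d b i" if "i < n" for i
        using dig[OF that] by (auto simp: mix_def split: if_splits)
      then show "a = b" using digit_eqI[of a "qubits n" b] ab by simp
    qed (simp add: a'_def b'_def)
    moreover have "a' = a" if "a = b"
      using that ab index_digit[of b "qubits n"] by (simp add: a'_def mix_def[abs_def])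
    moreover have "(\<forall>i<n. ?d a' i = 0 \<and> ?d b' i = 1) \<longleftrightarrow> a = s \<and> b = t"
      unfolding s_def t_def eq_ind_index_iff[OF ab(1)] eq_ind_index_iff[OF ab(2)] using dig by (auto simp: mix_def)
    moreover have "(\<forall>i<n. ?d a' i = 1 \<and> ?d b' i = 0) \<longleftrightarrow> a = t \<and> b = s"
      unfolding s_def t_def eq_ind_index_iff[OF ab(1)] eq_ind_index_iff[OF ab(2)] using dig by (auto simp: mix_def)
    ultimately show ?thesis
      unfolding partial_transpose_def a'_def[symmetric] b'_def[symmetric] noisy_ghz_index[OF less] by auto
  qed
  ultimately show ?thesis
    unfolding ppt_def by (subst psd_on_cong) auto
qed

section \<open>Fidelity of PPT states with the GHZ state\<close>

lemma fidelity_ghz_le_half: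
  assumes n: "2 \<le> n" and \<sigma>: "\<sigma> \<in> carrier_mat (2 ^ n) (2 ^ n)" and tr: "trace \<sigma> = 1"
    and psd: "ppt {} (qubits n) \<sigma>" and ppt: "ppt {0} (qubits n) \<sigma>"
  shows "fidelity \<sigma> (ghz n) \<le> 1 / 2"
proof -
  define x where "x = const_index n 0"
  define y where "y = const_index n 1"
  define s where "s = ind_index n {0}"
  define t where "t = ind_index n (- {0})"
  have lt: "x < 2 ^ n" "y < 2 ^ n" "s < 2 ^ n" "t < 2 ^ n"
    by (simp_all add: x_def y_def s_def t_def const_index_less ind_index_less)
  have dig: "digit (qubits n) x i = 0" "digit (qubits n) y i = 1"
    "digit (qubits n) s i = of_bool (i = 0)" "digit (qubits n) t i = of_bool (i \<noteq> 0)" if "i < n" for i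
    using that by (simp_all add: x_def y_def s_def t_def digit_const_index digit_ind_index)
  \<comment> \<open>Needs two qubits: for \<open>n = 1\<close> the strings \<open>s\<close> and
    \<open>t\<close> would be \<open>y\<close> and \<open>x\<close>, and the four populations used
    below would be counted twice.\<close>
  have ne: "x \<noteq> y" "x \<noteq> s" "x \<noteq> t" "y \<noteq> s" "y \<noteq> t" "s \<noteq> t"
    using n dig[of 0] dig[of 1] by auto
  have pos: "positive_semidef \<sigma>" using psd ppt_empty_iff[of \<sigma> "qubits n"] \<sigma> by simp
  then have psd': "psd_on {..<2 ^ n} (kernel_of \<sigma>)" using positive_semidef_iff[OF \<sigma>] by simp
  let ?K = "partial_transpose {0} (qubits n) \<sigma>"
  have K: "?K s t = \<sigma> $$ (x, y)"
    unfolding partial_transpose_def x_def y_def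
    by (intro arg_cong2[where f = "\<lambda>u v. \<sigma> $$ (u, v)"] index_cong) (auto simp: mix_def dig)
  have diag: "?K a a = \<sigma> $$ (a, a)" if "a < 2 ^ n" for a
    using that index_digit[of a "qubits n"] by (simp add: partial_transpose_def mix_def[abs_def])
  have off: "2 * Re (\<sigma> $$ (x, y)) \<le> Re (\<sigma> $$ (s, s)) + Re (\<sigma> $$ (t, t))"
    using psd_on_offdiag[of "{..<2 ^ n}" ?K s t] ppt lt ne by (simp add: ppt_def K diag)
  have herm: "\<sigma> $$ (y, x) = cnj (\<sigma> $$ (x, y))"
    using psd_on_hermitian[OF psd', of x y] lt by simp
  have "(\<sigma> *\<^sub>v ghz_vec n) \<bullet>c ghz_vec n =
      (\<Sum>a<2 ^ n. \<Sum>b<2 ^ n. ghz_vec n $ b * cnj (ghz_vec n $ a) * \<sigma> $$ (a, b))"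
    using cscalar_mult_mat_vec[OF \<sigma> ghz_vec_carrier] by (simp add: ac_simps)
  also have "\<dots> = (\<Sum>b<2 ^ n. \<Sum>a<2 ^ n. ghz_vec n $ b * cnj (ghz_vec n $ a) * \<sigma> $$ (a, b))"
    by (rule sum.swap)
  also have "\<dots> = (\<sigma> $$ (x, x) + \<sigma> $$ (y, x) + (\<sigma> $$ (x, y) + \<sigma> $$ (y, y))) / 2"
    unfolding sum_ghz by (simp add: x_def y_def sum_lessThan_2 algebra_simps)
  finally have eq: "(\<sigma> *\<^sub>v ghz_vec n) \<bullet>c ghz_vec n =
      (\<sigma> $$ (x, x) + \<sigma> $$ (y, x) + (\<sigma> $$ (x, y) + \<sigma> $$ (y, y))) / 2" .
  have "fidelity \<sigma> (ghz n) = (Re (\<sigma> $$ (x, x)) + 2 * Re (\<sigma> $$ (x, y)) + Re (\<sigma> $$ (y, y))) / 2"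
    unfolding ghz_eq_outer fidelity_outer[OF \<sigma> pos ghz_vec_carrier] eq by (simp add: herm)
  \<comment> \<open>Twice the fidelity is thus at most a sum of four distinct populations, hence at
    most the trace.\<close>
  also have "\<dots> \<le> (\<Sum>a\<in>{x, y, s, t}. Re (\<sigma> $$ (a, a))) / 2"
    using off ne by simp
  also have "(\<Sum>a\<in>{x, y, s, t}. Re (\<sigma> $$ (a, a))) \<le> (\<Sum>a<2 ^ n. Re (\<sigma> $$ (a, a)))"
    using lt psd_on_diag[OF psd'] by (intro sum_mono2) (auto simp: less_eq_complex_def)
  also have "(\<Sum>a<2 ^ n. Re (\<sigma> $$ (a, a))) = 1"
    using tr trace_eq_sum_diag[OF \<sigma>] by (simp flip: Re_sum)
  finally show ?thesis by simp
qed

lemma not_ghz_distillable: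
  assumes n: "2 \<le> n" and \<rho>: "\<rho> \<in> carrier_mat (2 ^ n) (2 ^ n)" "trace \<rho> = 1"
    and ppt: "ppt {} (qubits n) \<rho>" "ppt {0} (qubits n) \<rho>"
  shows "\<not> ghz_distillable n \<rho>"
proof
  assume "ghz_distillable n \<rho>"
  then obtain \<Lambda> where \<Lambda>: "\<And>k. locc (replicate n (2 ^ k)) (qubits n) (\<Lambda> k)"
    and lim: "(\<lambda>k. fidelity (\<Lambda> k (copies n k \<rho>)) (ghz n)) \<longlonglongrightarrow> 1"
    unfolding ghz_distillable_def by blast
  have "fidelity (\<Lambda> k (copies n k \<rho>)) (ghz n) \<le> 1 / 2" for k
  proof -
    have "copies n k \<rho> \<in> carrier_mat (prod_list (replicate n (2 ^ k))) (prod_list (replicate n (2 ^ k)))"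
      by (simp add: copies_def)
    note pres = locc_preserves[OF \<Lambda> this]
    show ?thesis
      using pres[of "{}"] pres[of "{0}"] ppt[THEN ppt_copies] trace_copies[OF \<rho>(1)] \<rho>(2)
      by (intro fidelity_ghz_le_half n) auto
  qed
  then have "1 \<le> (1 / 2 :: real)" by (intro LIMSEQ_le_const2[OF lim]) auto
  then show False by simp
qed

theorem theorem2:
  fixes p :: real
  assumes "0 \<le> p" and "p < 1"
  shows "\<exists>n\<^sub>0. \<forall>n\<ge>n\<^sub>0. \<not> ghz_distillable n (tensor_power_map n (teleport p) (ghz n))"
proof -
  define q where "q = (1 + p) / 2"
  have q: "0 < q" "p < q" using assms by (simp_all add: q_def)
  \<comment> \<open>Divided by \<open>q ^ n\<close>, the requirement
    \<open>p ^ n \<le> (1 - p) / 2 * q ^ (n - 1)\<close> for the cut at party 0 has a positive right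
    side independent of \<open>n\<close>, while the left side tends to 0.\<close>
  have "(\<lambda>n. (p / q) ^ n) \<longlonglongrightarrow> 0"
    using assms q by (intro LIMSEQ_realpow_zero) auto
  then have "\<forall>\<^sub>F n in sequentially. (p / q) ^ n < (1 - p) / 2 / q"
    using assms q by (intro order_tendstoD) auto
  then obtain N where N: "\<And>n. n \<ge> N \<Longrightarrow> (p / q) ^ n < (1 - p) / 2 / q"
    unfolding eventually_sequentially by blast
  show ?thesis
  proof (intro exI allI impI)
    fix n assume "max N 2 \<le> n"
    then have n: "N \<le> n" "2 \<le> n" by auto
    \<comment> \<open>This is the requirement of \<open>ppt_noisy_ghz\<close> for
      \<open>S = {}\<close>.\<close>
    have "p ^ n \<le> q ^ n" using assms q by (intro power_mono) auto
    then have "ppt {} (qubits n) (noisy_ghz n p)"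
      using n assms by (intro ppt_noisy_ghz) (auto simp: q_def)
    moreover have "p ^ n \<le> (\<Prod>i<n. if i \<in> {0} then (1 - p) / 2 else (1 + p) / 2)"
    proof -
      have "p ^ n = (p / q) ^ n * q ^ n" using q by (simp add: power_divide)
      also have "\<dots> \<le> (1 - p) / 2 / q * q ^ n"
        using N[OF n(1)] q by (intro mult_right_mono) auto
      also have "\<dots> = (1 - p) / 2 * q ^ (n - 1)"
        using n q by (cases n) auto
      also have "\<dots> = (\<Prod>i<n. if i \<in> {0} then (1 - p) / 2 else q)"
        using n by (cases n) (simp_all add: prod.lessThan_Suc_shift del: prod.lessThan_Suc)
      finally show ?thesis by (simp only: q_def)
    qed
    then have "ppt {0} (qubits n) (noisy_ghz n p)"
      using n assms by (intro ppt_noisy_ghz) auto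
    ultimately show "\<not> ghz_distillable n (noisy_ghz n p)"
      using n by (intro not_ghz_distillable trace_noisy_ghz noisy_ghz_carrier) auto
  qed
qed

end
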